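(* Let $1<r<r_0$ and $u_0\in L^r(\Omega)$. Then any solution $u(t;u_0)$ of (P) satisfies, for any $1\le\alpha<r$, $$u(t;u_0)\to u_0\quad\text{as }t\to0,\ \text{in }L^\alpha_{\rm loc}(\Omega).$$
   Context: Setting. $\Omega\subset\mathbb{R}^N$, $N\ge1$, is a bounded domain with smooth boundary $\Gamma$ and outward unit normal $\vec n$. The functions $f,g\in C^1(\mathbb{R})$ satisfy, for all $s\in\mathbb{R}$, $$pc_f|s|^{p-1}-A_0\le f'(s)\le pC_f|s|^{p-1}+A_1,\qquad qc_g|s|^{q-1}-B_0\le g'(s)\le qC_g|s|^{q-1}+B_1,$$ for some constants $c_f,c_g,C_f,C_g>0$, $A_0,A_1,B_0,B_1>0$ and exponents $1<p,q<\infty$ with $p+1>2q$ and $p>1+\frac2N$. Put $r_0=\max\{\frac N2(p-1),N(q-1)\}=\frac N2(p-1)>1$. Problem (P) is $$u_t-\Delta u+f(u)=0\ \text{in }\Omega,\qquad \frac{\partial u}{\partial\vec n}=g(u)\ \text{on }\Gamma,\qquad u(0)=u_0 .$$ Truncation. Fix a family $\{g_K\}_{K>0}\subset C^1(\mathbb{R})$ with: $sg_{K_1}(s)\le sg_{K_2}(s)\le sg(s)$ for all $s\in\mathbb{R}$, $0<K_1<K_2$; $-B_0\le g_K'(s)\le K$ for all $s$; and $g_K=g$ on an interval $[a_K,b_K]$ with $a_K\to-\infty$, $b_K\to\infty$ as $K\to\infty$. Notation. $S(t)$ is the semigroup generated by $\Delta$ with homogeneous Neumann boundary conditions in $L^r(\Omega)$;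 it acts on functions $h$ on $\Omega$ by $(S(t)h)(x)=\int_\Omega k(t,x,y)h(y)\,dy$ and on functions $h$ on $\Gamma$ by $(S(t)h)(x)=\int_\Gamma k(t,x,y)h(y)\,d\sigma(y)$, where $k$ is the Neumann heat kernel. $f_\Omega$ denotes the Nemitsky operator of $f$ on functions defined in $\Omega$, and $(g_K)_\Gamma$ that of $g_K$ acting on traces on $\Gamma$. $H^\alpha_\sigma(\Omega)$ is the Bessel potential space of order $\alpha$ based on $L^\sigma(\Omega)$. The functions $v^K$. For $1<r<r_0$ and $u_0\in L^r(\Omega)$, $v^K=v^K(\cdot;u_0)$ denotes the unique function with $v^K(0)=u_0$ and, for all $0<\varepsilon<T$, $v^K\in C([0,T];L^r(\Omega))\cap C([\varepsilon,T]\times\overline\Omega)$ and $v^K(t)=S(t-\varepsilon)v^K(\varepsilon)+\int_\varepsilon^tS(t-s)\big(-f_\Omega(v^K(s))+(g_K)_\Gamma(v^K(s))\big)ds$ for $\varepsilon\le t\le T$; it is a classical solution for $t>0$ of (P) with $g$ replaced by $g_K$. Solutions of (P). For $1<r<r_0$ and $u_0\in L^r(\Omega)$, a solution $u(\cdot;u_0)$ of (P) is any function $v$ with $v(0)=u_0$ such that, for some sequence $K_j\to\infty$, $v^{K_j}(\cdot;u_0)\to v$ in $C_{\rm loc}((0,\infty);H^\alpha_\sigma(\Omega))$ for all $\sigma\ge r$ and $\alpha<1+\frac1\sigma$ (such limits exist). *)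

theory Defs
  imports "HOL-Analysis.Analysis"
begin

section \<open>Smooth bounded domains\<close>

definition partial :: "'a::euclidean_space \<Rightarrow> ('a \<Rightarrow> real) \<Rightarrow> 'a \<Rightarrow> real" where
  "partial b f x = frechet_derivative f (at x) b"

text \<open>\<open>U\<close> is meant to be open.\<close>

primrec Ck_on :: "nat \<Rightarrow> 'a::euclidean_space set \<Rightarrow> ('a \<Rightarrow> real) \<Rightarrow> bool" where
  "Ck_on 0 U f \<longleftrightarrow> continuous_on U f"
| "Ck_on (Suc n) U f \<longleftrightarrow>
     (\<forall>x\<in>U. f differentiable (at x)) \<and> (\<forall>b\<in>Basis. Ck_on n U (partial b f))"

definition smooth_on :: "'a::euclidean_space set \<Rightarrow> ('a \<Rightarrow> real) \<Rightarrow> bool" where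
  "smooth_on U f \<longleftrightarrow> (\<forall>n. Ck_on n U f)"

text \<open>Near a boundary point the domain is the negativity set of a smooth function without critical
  points; the domain thus lies locally on one side of its boundary.\<close>

definition defining_function ::
  "'a::euclidean_space set \<Rightarrow> 'a \<Rightarrow> 'a set \<Rightarrow> ('a \<Rightarrow> real) \<Rightarrow> bool" where
  "defining_function \<Omega> x U \<phi> \<longleftrightarrow>
     open U \<and> x \<in> U \<and> smooth_on U \<phi> \<and>
     (\<forall>y\<in>U. \<exists>G. (GDERIV \<phi> y :> G) \<and> G \<noteq> 0) \<and>
     \<Omega> \<inter> U = {y\<in>U. \<phi> y < 0}"

definition smooth_bounded_domain :: "'a::euclidean_space set \<Rightarrow> bool" where
  "smooth_bounded_domain \<Omega> \<longleftrightarrow>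
     open \<Omega> \<and> connected \<Omega> \<and> bounded \<Omega> \<and> \<Omega> \<noteq> {} \<and>
     (\<forall>x\<in>frontier \<Omega>. \<exists>U \<phi>. defining_function \<Omega> x U \<phi>)"

definition outward_normal :: "'a::euclidean_space set \<Rightarrow> 'a \<Rightarrow> 'a" where
  "outward_normal \<Omega> x =
     (THE \<nu>. \<exists>U \<phi> G. defining_function \<Omega> x U \<phi> \<and> (GDERIV \<phi> x :> G) \<and> \<nu> = sgn G)"

text \<open>The surface measure is the \<open>(N-1)\<close>-dimensional Hausdorff measure, normalised so that
  \<open>d\<close>-dimensional Hausdorff measure is \<open>d\<close>-dimensional area. For \<open>d = 0\<close>, where \<open>0 ^ 0 = 1\<close>, it is
  counting measure.\<close>

definition hausdorff_outer :: "nat \<Rightarrow> real \<Rightarrow> 'a::euclidean_space set \<Rightarrow> ennreal" where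
  "hausdorff_outer d \<delta> A =
     (INF C\<in>{C :: nat \<Rightarrow> 'a set. A \<subseteq> (\<Union>i. C i) \<and> (\<forall>i. bounded (C i) \<and> diameter (C i) \<le> \<delta>)}.
        \<Sum>i. if C i = {} then 0
            else ennreal (unit_ball_vol (real d) * (diameter (C i) / 2) ^ d))"

definition hausdorff_measure :: "nat \<Rightarrow> 'a::euclidean_space measure" where
  "hausdorff_measure d =
     measure_of UNIV (sets borel) (\<lambda>A. SUP \<delta>\<in>{0<..}. hausdorff_outer d \<delta> A)"

definition surface_measure :: "'a::euclidean_space measure" where
  "surface_measure = hausdorff_measure (DIM('a) - 1)"

section \<open>Function spaces\<close>

definition Lp_space :: "real \<Rightarrow> 'a::euclidean_space set \<Rightarrow> ('a \<Rightarrow> real) set" where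
  "Lp_space r A = {h \<in> borel_measurable (lebesgue_on A).
                     integrable (lebesgue_on A) (\<lambda>x. \<bar>h x\<bar> powr r)}"

definition Lp_norm :: "real \<Rightarrow> 'a::euclidean_space set \<Rightarrow> ('a \<Rightarrow> real) \<Rightarrow> real" where
  "Lp_norm r A h = (LINT x|lebesgue_on A. \<bar>h x\<bar> powr r) powr (1 / r)"

definition Lp_loc_space :: "real \<Rightarrow> 'a::euclidean_space set \<Rightarrow> ('a \<Rightarrow> real) set" where
  "Lp_loc_space r A = {h. \<forall>C. compact C \<and> C \<subseteq> A \<longrightarrow> h \<in> Lp_space r C}"

definition tendsto_Lp_loc ::
  "real \<Rightarrow> 'a::euclidean_space set \<Rightarrow> ('b \<Rightarrow> 'a \<Rightarrow> real) \<Rightarrow> ('a \<Rightarrow> real) \<Rightarrow> 'b filter \<Rightarrow> bool" where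
  "tendsto_Lp_loc r A u l F \<longleftrightarrow>
     l \<in> Lp_loc_space r A \<and> (\<forall>\<^sub>F t in F. u t \<in> Lp_loc_space r A) \<and>
     (\<forall>C. compact C \<and> C \<subseteq> A \<longrightarrow> ((\<lambda>t. Lp_norm r C (\<lambda>x. u t x - l x)) \<longlongrightarrow> 0) F)"

text \<open>The Bessel kernel of order \<open>\<alpha> > 0\<close>: the convolution kernel of \<open>(1 - \<Delta>)\<close> to the power
  \<open>-\<alpha>/2\<close> on the whole space, as the Gamma-function average of the Gauss kernels.\<close>

definition bessel_kernel :: "real \<Rightarrow> 'a::euclidean_space \<Rightarrow> real" where
  "bessel_kernel \<alpha> x =
     (LINT t:{0<..}|lebesgue.
        t powr (\<alpha> / 2 - 1) * exp (- t) * (4 * pi * t) powr (- real DIM('a) / 2)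
          * exp (- (norm x)\<^sup>2 / (4 * t))) / Gamma (\<alpha> / 2)"

definition bessel_potential ::
  "real \<Rightarrow> ('a::euclidean_space \<Rightarrow> real) \<Rightarrow> 'a \<Rightarrow> real" where
  "bessel_potential \<alpha> h x =
     (if \<alpha> = 0 then h x else LINT y|lebesgue. bessel_kernel \<alpha> (x - y) * h y)"

text \<open>For \<open>\<alpha> \<ge> 0\<close>, the Bessel potential space on \<open>\<Omega>\<close> consists of the restrictions to \<open>\<Omega>\<close> of
  potentials of functions in \<open>L\<^sup>\<sigma>\<close> of the whole space, with the quotient norm.\<close>

definition bessel_space ::
  "real \<Rightarrow> real \<Rightarrow> 'a::euclidean_space set \<Rightarrow> ('a \<Rightarrow> real) set" where
  "bessel_space \<alpha> \<sigma> \<Omega> =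
     {w. \<exists>h\<in>Lp_space \<sigma> UNIV. AE x in lebesgue_on \<Omega>. w x = bessel_potential \<alpha> h x}"

definition bessel_norm ::
  "real \<Rightarrow> real \<Rightarrow> 'a::euclidean_space set \<Rightarrow> ('a \<Rightarrow> real) \<Rightarrow> real" where
  "bessel_norm \<alpha> \<sigma> \<Omega> w =
     Inf {Lp_norm \<sigma> UNIV h | h.
            h \<in> Lp_space \<sigma> UNIV \<and> (AE x in lebesgue_on \<Omega>. w x = bessel_potential \<alpha> h x)}"

definition continuous_path ::
  "('a \<Rightarrow> real) set \<Rightarrow> (('a \<Rightarrow> real) \<Rightarrow> real) \<Rightarrow> real set \<Rightarrow> (real \<Rightarrow> 'a \<Rightarrow> real) \<Rightarrow> bool" where
  "continuous_path X nrm I v \<longleftrightarrow>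
     (\<forall>t\<in>I. v t \<in> X \<and> ((\<lambda>s. nrm (\<lambda>x. v s x - v t x)) \<longlongrightarrow> 0) (at t within I))"

definition converges_Cloc ::
  "('a \<Rightarrow> real) set \<Rightarrow> (('a \<Rightarrow> real) \<Rightarrow> real) \<Rightarrow>
     (nat \<Rightarrow> real \<Rightarrow> 'a \<Rightarrow> real) \<Rightarrow> (real \<Rightarrow> 'a \<Rightarrow> real) \<Rightarrow> bool" where
  "converges_Cloc X nrm V v \<longleftrightarrow>
     (\<forall>j. continuous_path X nrm {0<..} (V j)) \<and> continuous_path X nrm {0<..} v \<and>
     (\<forall>a b e. 0 < a \<and> a \<le> b \<and> 0 < e \<longrightarrow>
        (\<forall>\<^sub>F j in sequentially. \<forall>t\<in>{a..b}. nrm (\<lambda>x. V j t x - v t x) < e))"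

section \<open>The parabolic problem\<close>

definition laplacian :: "('a::euclidean_space \<Rightarrow> real) \<Rightarrow> 'a \<Rightarrow> real" where
  "laplacian w x = (\<Sum>b\<in>Basis. partial b (partial b w) x)"

text \<open>\<open>G\<close> is the spatial gradient of \<open>v\<close> in \<open>\<Omega>\<close> together with its continuous extension to the
  closure, through which the normal derivative is expressed.\<close>

definition classical_solution ::
  "'a::euclidean_space set \<Rightarrow> (real \<Rightarrow> real) \<Rightarrow> (real \<Rightarrow> real) \<Rightarrow> (real \<Rightarrow> 'a \<Rightarrow> real) \<Rightarrow> bool" where
  "classical_solution \<Omega> f g v \<longleftrightarrow>
     continuous_on ({0<..} \<times> closure \<Omega>) (\<lambda>(t, x). v t x) \<and>
     (\<forall>t>0. Ck_on 2 \<Omega> (v t)) \<and>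
     (\<forall>b\<in>Basis. \<forall>c\<in>Basis.
        continuous_on ({0<..} \<times> \<Omega>) (\<lambda>(t, x). partial b (partial c (v t)) x)) \<and>
     (\<forall>t>0. \<forall>x\<in>\<Omega>. (\<lambda>s. v s x) differentiable (at t)) \<and>
     continuous_on ({0<..} \<times> \<Omega>) (\<lambda>(t, x). deriv (\<lambda>s. v s x) t) \<and>
     (\<forall>t>0. \<forall>x\<in>\<Omega>. deriv (\<lambda>s. v s x) t - laplacian (v t) x + f (v t x) = 0) \<and>
     (\<exists>G :: real \<Rightarrow> 'a \<Rightarrow> 'a.
        continuous_on ({0<..} \<times> closure \<Omega>) (\<lambda>(t, x). G t x) \<and>
        (\<forall>t>0. \<forall>x\<in>\<Omega>. GDERIV (v t) x :> G t x) \<and>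
        (\<forall>t>0. \<forall>x\<in>frontier \<Omega>. G t x \<bullet> outward_normal \<Omega> x = g (v t x)))"

text \<open>The Neumann heat kernel is the fundamental solution of the heat equation under homogeneous
  Neumann conditions. These conditions determine it for positive times.\<close>

definition neumann_heat_kernel ::
  "'a::euclidean_space set \<Rightarrow> (real \<Rightarrow> 'a \<Rightarrow> 'a \<Rightarrow> real) \<Rightarrow> bool" where
  "neumann_heat_kernel \<Omega> k \<longleftrightarrow>
     continuous_on ({0<..} \<times> closure \<Omega> \<times> closure \<Omega>) (\<lambda>(t, x, y). k t x y) \<and>
     (\<forall>y\<in>closure \<Omega>. classical_solution \<Omega> (\<lambda>_. 0) (\<lambda>_. 0) (\<lambda>t x. k t x y)) \<and>
     (\<forall>h :: 'a \<Rightarrow> real. continuous_on (closure \<Omega>) h \<longrightarrow>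
        uniform_limit (closure \<Omega>) (\<lambda>t x. LINT y:\<Omega>|lebesgue. k t x y * h y) h (at_right 0))"

definition S_interior ::
  "'a::euclidean_space set \<Rightarrow> (real \<Rightarrow> 'a \<Rightarrow> 'a \<Rightarrow> real) \<Rightarrow> real \<Rightarrow> ('a \<Rightarrow> real) \<Rightarrow> 'a \<Rightarrow> real" where
  "S_interior \<Omega> k t h x = (if t = 0 then h x else LINT y:\<Omega>|lebesgue. k t x y * h y)"

definition S_boundary ::
  "'a::euclidean_space set \<Rightarrow> (real \<Rightarrow> 'a \<Rightarrow> 'a \<Rightarrow> real) \<Rightarrow> real \<Rightarrow> ('a \<Rightarrow> real) \<Rightarrow> 'a \<Rightarrow> real" where
  "S_boundary \<Omega> k t h x = (LINT y:frontier \<Omega>|surface_measure. k t x y * h y)"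

text \<open>In the variation of constants formula the value of the integrand at \<open>s = t\<close> is irrelevant.
  Traces of \<open>v s\<close> are its values on \<open>frontier \<Omega>\<close>, as \<open>v\<close> is continuous up to the boundary.\<close>

definition mild_solution ::
  "'a::euclidean_space set \<Rightarrow> (real \<Rightarrow> 'a \<Rightarrow> 'a \<Rightarrow> real) \<Rightarrow> (real \<Rightarrow> real) \<Rightarrow> (real \<Rightarrow> real) \<Rightarrow>
     real \<Rightarrow> ('a \<Rightarrow> real) \<Rightarrow> (real \<Rightarrow> 'a \<Rightarrow> real) \<Rightarrow> bool" where
  "mild_solution \<Omega> k f g r u0 v \<longleftrightarrow>
     (AE x in lebesgue_on \<Omega>. v 0 x = u0 x) \<and>
     (\<forall>\<epsilon> T. 0 < \<epsilon> \<and> \<epsilon> < T \<longrightarrow>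
        continuous_path (Lp_space r \<Omega>) (Lp_norm r \<Omega>) {0..T} v \<and>
        continuous_on ({\<epsilon>..T} \<times> closure \<Omega>) (\<lambda>(t, x). v t x) \<and>
        (\<forall>t\<in>{\<epsilon>..T}. \<forall>x\<in>closure \<Omega>.
           v t x = S_interior \<Omega> k (t - \<epsilon>) (v \<epsilon>) x +
             (LINT s:{\<epsilon>..t}|lebesgue.
                S_interior \<Omega> k (t - s) (\<lambda>y. - f (v s y)) x +
                S_boundary \<Omega> k (t - s) (\<lambda>y. g (v s y)) x)))"

text \<open>With \<open>g\<close> the truncated nonlinearity. The mild solution is unique and is classical for
  positive times.\<close>

definition truncated_solution ::
  "'a::euclidean_space set \<Rightarrow> (real \<Rightarrow> 'a \<Rightarrow> 'a \<Rightarrow> real) \<Rightarrow> (real \<Rightarrow> real) \<Rightarrow> (real \<Rightarrow> real) \<Rightarrow>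
     real \<Rightarrow> ('a \<Rightarrow> real) \<Rightarrow> (real \<Rightarrow> 'a \<Rightarrow> real) \<Rightarrow> bool" where
  "truncated_solution \<Omega> k f g r u0 v \<longleftrightarrow>
     mild_solution \<Omega> k f g r u0 v \<and> classical_solution \<Omega> f g v"

text \<open>Orders \<open>\<alpha> < 0\<close> are left out: convergence for \<open>\<alpha> = 0\<close> implies convergence for them.\<close>

definition solution_P ::
  "'a::euclidean_space set \<Rightarrow> (real \<Rightarrow> 'a \<Rightarrow> 'a \<Rightarrow> real) \<Rightarrow> (real \<Rightarrow> real) \<Rightarrow>
     (real \<Rightarrow> real \<Rightarrow> real) \<Rightarrow> real \<Rightarrow> ('a \<Rightarrow> real) \<Rightarrow> (real \<Rightarrow> 'a \<Rightarrow> real) \<Rightarrow> bool" where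
  "solution_P \<Omega> k f gK r u0 u \<longleftrightarrow>
     (AE x in lebesgue_on \<Omega>. u 0 x = u0 x) \<and>
     (\<exists>(K :: nat \<Rightarrow> real) V.
        (\<forall>j. 0 < K j) \<and> filterlim K at_top sequentially \<and>
        (\<forall>j. truncated_solution \<Omega> k f (gK (K j)) r u0 (V j)) \<and>
        (\<forall>\<sigma> \<alpha>. r \<le> \<sigma> \<and> 0 \<le> \<alpha> \<and> \<alpha> < 1 + 1 / \<sigma> \<longrightarrow>
           converges_Cloc (bessel_space \<alpha> \<sigma> \<Omega>) (bessel_norm \<alpha> \<sigma> \<Omega>) V u))"

section \<open>The nonlinearities\<close>

definition power_growth ::
  "real \<Rightarrow> real \<Rightarrow> real \<Rightarrow> real \<Rightarrow> real \<Rightarrow> (real \<Rightarrow> real) \<Rightarrow> bool" where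
  "power_growth p c C A0 A1 f \<longleftrightarrow>
     f C1_differentiable_on UNIV \<and>
     (\<forall>s. p * c * \<bar>s\<bar> powr (p - 1) - A0 \<le> deriv f s \<and>
          deriv f s \<le> p * C * \<bar>s\<bar> powr (p - 1) + A1)"

definition truncation_family ::
  "real \<Rightarrow> (real \<Rightarrow> real) \<Rightarrow> (real \<Rightarrow> real \<Rightarrow> real) \<Rightarrow> bool" where
  "truncation_family B0 g gK \<longleftrightarrow>
     (\<forall>K>0. gK K C1_differentiable_on UNIV) \<and>
     (\<forall>K1 K2 s. 0 < K1 \<and> K1 < K2 \<longrightarrow> s * gK K1 s \<le> s * gK K2 s \<and> s * gK K2 s \<le> s * g s) \<and>
     (\<forall>K>0. \<forall>s. - B0 \<le> deriv (gK K) s \<and> deriv (gK K) s \<le> K) \<and>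
     (\<exists>a b :: real \<Rightarrow> real.
        filterlim a at_bot at_top \<and> filterlim b at_top at_top \<and>
        (\<forall>K>0. a K \<le> b K \<and> (\<forall>s\<in>{a K..b K}. gK K s = g s)))"

end

theory Submission
  imports Defs
begin

text \<open>The approximations \<open>V j\<close> all solve the equation in the interior, and the boundary condition, the only
  place where \<open>j\<close> enters, is invisible after localisation. Let \<open>w\<close> be a polynomial close to \<open>u0\<close> on a cube in \<open>\<Omega>\<close>,
  \<open>z = V j t - w\<close>, and \<open>\<phi> = \<eta> ^ (2 k + 2)\<close> a cutoff. Differentiating the integral of \<open>\<phi> (\<delta> + z\<^sup>2) powr (r / 2)\<close> in \<open>t\<close>
  and moving the Laplacian to \<open>\<phi>\<close> leaves a term of size \<open>\<eta> ^ (2 k) \<bar>z\<bar> powr r\<close>, which the absorption term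
  \<open>- \<eta> ^ (2 k + 2) \<bar>z\<bar> powr (r + p - 1)\<close> coming from \<open>f\<close> dominates up to a constant, since \<open>p > 1\<close> and \<open>k\<close> is large.
  So the energy at time \<open>t\<close> exceeds the initial one by at most \<open>K t\<close> with \<open>K\<close> independent of \<open>j\<close>. Letting
  \<open>j \<rightarrow> \<infinity>\<close>, then \<open>t \<rightarrow> 0\<close>, then \<open>w \<rightarrow> u0\<close> gives convergence in \<open>L\<^sup>r\<close> locally, hence for every smaller exponent.\<close>

section \<open>Directional derivatives and integration by parts\<close>

text \<open>The obstacle is a lack of uniformity: the speed at which \<open>V j s\<close> approaches
  \<open>u0\<close> as \<open>s\<close> tends to 0 depends on \<open>j\<close>, and the speed at
  which \<open>V j t\<close> approaches \<open>u t\<close> depends on \<open>t\<close>. Only the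
  growth constant of the energy is common to all \<open>j\<close>. The energy is compared at two
  positive times, since the \<open>V j\<close> are classical only there, and their continuity at
  time 0 in the \<open>r\<close>-th power integral closes the gap. The datum \<open>u0\<close>
  cannot be subtracted from the equation, as it has no Laplacian; the polynomial \<open>w\<close>
  can, at the price of its Laplacian as a bounded source. The constant may grow without bound as
  \<open>w\<close> approaches \<open>u0\<close>, which is harmless because \<open>w\<close> is fixed
  before \<open>t\<close>. The shift by \<delta> is there because
  \<open>\<bar>z\<bar> powr r\<close> is not twice differentiable at 0 when \<open>r < 2\<close>.
  "Large" for \<open>k\<close> means \<open>r \<le> k * (p - 1)\<close>: two derivatives cost two
  factors \<eta>, and each pair of factors \<eta> is matched with one power \<open>p - 1\<close> of
  \<open>\<bar>z\<bar>\<close>.\<close>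

definition has_dir_deriv ::
  "('a::real_normed_vector \<Rightarrow> real) \<Rightarrow> 'a \<Rightarrow> real \<Rightarrow> 'a \<Rightarrow> bool" where
  "has_dir_deriv F b d x \<longleftrightarrow> ((\<lambda>s. F (x + s *\<^sub>R b)) has_real_derivative d) (at 0)"

lemma has_dir_deriv_transform_open:
  assumes "has_dir_deriv F b d x" "open U" "x \<in> U" "\<And>y. y \<in> U \<Longrightarrow> F y = G y"
  shows "has_dir_deriv G b d x"
proof -
  have "open ((\<lambda>s::real. x + s *\<^sub>R b) -` U)"
    by (intro open_vimage assms continuous_intros)
  with assms show ?thesis
    unfolding has_dir_deriv_def
    by (elim has_field_derivative_transform_within_open) auto
qed

lemma has_dir_deriv_shift:
  assumes "has_dir_deriv F b d (x + t *\<^sub>R b)"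
  shows "((\<lambda>s. F (x + s *\<^sub>R b)) has_real_derivative d) (at t)"
  using assms DERIV_shift[of "\<lambda>s. F (x + s *\<^sub>R b)" d 0 t]
  unfolding has_dir_deriv_def by (simp add: algebra_simps)

lemma has_derivative_imp_has_dir_deriv:
  assumes "(F has_derivative F') (at x)"
  shows "has_dir_deriv F b (F' b) x"
proof -
  have "((\<lambda>s. F (x + s *\<^sub>R b)) has_derivative (\<lambda>s. F' (s *\<^sub>R b))) (at 0)"
    by (rule has_derivative_compose[where g=F, of "\<lambda>s. x + s *\<^sub>R b"])
       (use assms in \<open>auto intro!: derivative_eq_intros\<close>)
  moreover have "F' (s *\<^sub>R b) = F' b * s" for s
    using has_derivative_linear[OF assms] by (simp add: linear_scale mult.commute)
  ultimately show ?thesis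
    unfolding has_dir_deriv_def has_field_derivative_def by simp
qed

lemma has_dir_deriv_mult:
  assumes "has_dir_deriv F b d x" "has_dir_deriv G b e x"
  shows "has_dir_deriv (\<lambda>y. F y * G y) b (d * G x + F x * e) x"
  using assms unfolding has_dir_deriv_def
  by (auto intro!: derivative_eq_intros)

lemma has_dir_deriv_diff:
  assumes "has_dir_deriv F b d x" "has_dir_deriv G b e x"
  shows "has_dir_deriv (\<lambda>y. F y - G y) b (d - e) x"
  using assms unfolding has_dir_deriv_def
  by (auto intro!: derivative_eq_intros)

lemma has_dir_deriv_chain:
  assumes "(h has_real_derivative h') (at (F x))" "has_dir_deriv F b d x"
  shows "has_dir_deriv (\<lambda>y. h (F y)) b (h' * d) x"
  using assms unfolding has_dir_deriv_def
  by (intro DERIV_chain2[where g="\<lambda>s. F (x + s *\<^sub>R b)"]) auto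

text \<open>Passage between boxes: two boxes outside of which a function vanishes give the same
  integral, since both agree with the integral over the whole space.\<close>

lemma integral_eq_integral_UNIV:
  fixes F :: "'a::euclidean_space \<Rightarrow> real"
  assumes "continuous_on UNIV F" "\<And>x. x \<notin> cbox l u \<Longrightarrow> F x = 0"
  shows "integral (cbox l u) F = integral UNIV F"
proof -
  have "(F has_integral integral (cbox l u) F) (cbox l u)"
    using assms(1) by (meson continuous_on_subset integrable_continuous integrable_integral subset_UNIV)
  then have "(F has_integral integral (cbox l u) F) UNIV"
    by (rule has_integral_on_superset) (use assms(2) in auto)
  then show ?thesis by (simp add: integral_unique)
qed

text \<open>The integral of \<open>F (x + t b)\<close> over \<open>x\<close> does not depend on \<open>t\<close>; differentiate at \<open>t = 0\<close>.\<close>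

lemma integral_dir_deriv_eq_0:
  fixes F D :: "'a::euclidean_space \<Rightarrow> real"
  assumes S: "compact S" "S \<subseteq> cbox l u"
    and F0: "\<And>x. x \<notin> S \<Longrightarrow> F x = 0" and D0: "\<And>x. x \<notin> S \<Longrightarrow> D x = 0"
    and cont: "continuous_on UNIV F" "continuous_on UNIV D"
    and deriv: "\<And>x. has_dir_deriv F b (D x) x"
  shows "integral (cbox l u) D = 0"
proof -
  \<comment> \<open>\<open>T\<close> collects the supports of all translates
    \<open>F (x + t *\<^sub>R b)\<close> with \<open>t\<close> in \<open>{-1..1}\<close>. One box
    around it serves every \<open>t\<close>, as the Leibniz rule requires a fixed domain.\<close>
  define T where "T = (\<lambda>(x, t). x - t *\<^sub>R b) ` (S \<times> {-1..1::real})"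
  have "compact T"
    unfolding T_def by (intro compact_continuous_image compact_Times S)
      (auto simp: split_beta intro!: continuous_intros)
  then obtain a where a: "T \<subseteq> cbox (- a) a"
    using bounded_subset_cbox_symmetric compact_imp_bounded by metis
  have sh: "x - t *\<^sub>R b \<in> cbox (- a) a" if "x \<in> S" "t \<in> {-1..1}" for x t
    using a that unfolding T_def by force
  define G where "G t = integral (cbox (- a) a) (\<lambda>x. F (x + t *\<^sub>R b))" for t
  have Gc: "G t = integral UNIV F" if t: "t \<in> {-1..1}" for t
  proof -
    have "G t = integral (cbox (- a + t *\<^sub>R b) (a + t *\<^sub>R b)) F"
      using integral_shift_cbox[of "- a + t *\<^sub>R b" "t *\<^sub>R b" "a + t *\<^sub>R b" F]
      unfolding G_def by simp
    also have "\<dots> = integral UNIV F"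
    proof (rule integral_eq_integral_UNIV[OF cont(1)])
      fix x assume "x \<notin> cbox (- a + t *\<^sub>R b) (a + t *\<^sub>R b)"
      then have "x - t *\<^sub>R b \<notin> cbox (- a) a"
        by (auto simp: mem_box algebra_simps)
      then show "F x = 0" using sh[of x t] t F0[of x] by blast
    qed
    finally show ?thesis .
  qed
  have "(G has_field_derivative integral (cbox (- a) a) (\<lambda>x. D (x + 0 *\<^sub>R b))) (at 0 within {-1..1})"
    unfolding G_def
  proof (rule leibniz_rule_field_derivative)
    show "((\<lambda>t. F (x + t *\<^sub>R b)) has_field_derivative D (x + t *\<^sub>R b)) (at t within {- 1..1})" for t x
      by (rule has_field_derivative_at_within[OF has_dir_deriv_shift[OF deriv]])
    show "(\<lambda>x. F (x + t *\<^sub>R b)) integrable_on cbox (- a) a" for t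
      by (intro integrable_continuous continuous_on_compose2[OF cont(1)] continuous_intros) auto
    show "continuous_on ({- 1..1} \<times> cbox (- a) a) (\<lambda>(t, x). D (x + t *\<^sub>R b))"
      unfolding split_beta
      by (intro continuous_on_compose2[OF cont(2)] continuous_intros) auto
  qed auto
  moreover have "(G has_field_derivative 0) (at 0 within {-1..1})"
    by (rule has_field_derivative_transform_within[where f="\<lambda>_. integral UNIV F" and d=1]) (auto simp: Gc)
  ultimately have "integral (cbox (- a) a) D = 0"
    by (simp add: at_within_Icc_at DERIV_unique)
  \<comment> \<open>\<open>D\<close> vanishes outside either box, so the result moves from the
    auxiliary box to the given one.\<close>
  moreover have "D x = 0" if "x \<notin> cbox l u" for x
    using that S(2) D0 by auto
  moreover have "D x = 0" if "x \<notin> cbox (-a) a" for x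
    using that sh[of x 0] D0 by auto
  ultimately show ?thesis
    using integral_eq_integral_UNIV[OF cont(2)] by metis
qed

text \<open>The open sets \<open>\<Omega>\<close> and \<open>- S\<close> cover the space, and
  \<open>F\<close> is continuous on each, being 0 on the second. Products of a cutoff with functions
  that are regular only in \<open>\<Omega>\<close> thus become globally continuous.\<close>

lemma continuous_on_extend_by_zero:
  fixes F :: "'a::topological_space \<Rightarrow> real"
  assumes "open \<Omega>" "closed S" "S \<subseteq> \<Omega>" "continuous_on \<Omega> F" "\<And>x. x \<notin> S \<Longrightarrow> F x = 0"
  shows "continuous_on UNIV F"
proof -
  have "continuous_on (- S) F"
    using assms(5) by (subst continuous_on_cong[where g="\<lambda>_. 0"]) auto
  then have "continuous_on (\<Omega> \<union> - S) F"
    using assms by (intro continuous_on_open_Un) auto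
  moreover have "\<Omega> \<union> - S = UNIV" using assms by auto
  ultimately show ?thesis by simp
qed

text \<open>In the derivative of \<open>\<phi> x * J1 x - \<phi>1 x * J x\<close> along
  \<open>b\<close> the two products \<open>\<phi>1 x * J1 x\<close> cancel, so a single exact
  derivative performs both integrations by parts. Only one direction is involved, and the values of
  \<open>J\<close> outside \<open>\<Omega>\<close> do not matter.\<close>

lemma integral_by_parts_twice:
  fixes \<phi> \<phi>1 \<phi>2 J J1 J2 :: "'a::euclidean_space \<Rightarrow> real"
  assumes \<Omega>: "open \<Omega>" "cbox l u \<subseteq> \<Omega>" and S: "compact S" "S \<subseteq> cbox l u"
    and \<phi>: "\<And>x. has_dir_deriv \<phi> b (\<phi>1 x) x" "\<And>x. has_dir_deriv \<phi>1 b (\<phi>2 x) x"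
      "continuous_on UNIV \<phi>" "continuous_on UNIV \<phi>1" "continuous_on UNIV \<phi>2"
    and \<phi>0: "\<And>x. x \<notin> S \<Longrightarrow> \<phi> x = 0 \<and> \<phi>1 x = 0 \<and> \<phi>2 x = 0"
    and J: "\<And>x. x \<in> \<Omega> \<Longrightarrow> has_dir_deriv J b (J1 x) x" "\<And>x. x \<in> \<Omega> \<Longrightarrow> has_dir_deriv J1 b (J2 x) x"
      "continuous_on \<Omega> J" "continuous_on \<Omega> J1" "continuous_on \<Omega> J2"
  shows "integral (cbox l u) (\<lambda>x. \<phi> x * J2 x) = integral (cbox l u) (\<lambda>x. \<phi>2 x * J x)"
proof -
  have sub: "continuous_on \<Omega> \<phi>" "continuous_on \<Omega> \<phi>1" "continuous_on \<Omega> \<phi>2"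
    using \<phi>(3-5) continuous_on_subset by blast+
  define F where "F x = \<phi> x * J1 x - \<phi>1 x * J x" for x
  define D where "D x = \<phi> x * J2 x - \<phi>2 x * J x" for x
  have "integral (cbox l u) D = 0"
  proof (rule integral_dir_deriv_eq_0[OF S])
    show "F x = 0" "D x = 0" if "x \<notin> S" for x
      using \<phi>0[OF that] by (auto simp: F_def D_def)
    moreover have "continuous_on \<Omega> F" "continuous_on \<Omega> D"
      unfolding F_def D_def by (intro continuous_intros J sub)+
    ultimately show "continuous_on UNIV F" "continuous_on UNIV D"
      using continuous_on_extend_by_zero[OF \<Omega>(1) compact_imp_closed[OF S(1)] order_trans[OF S(2) \<Omega>(2)]]
      by blast+
    show "has_dir_deriv F b (D x) x" for x
    proof (cases "x \<in> \<Omega>")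
      case True
      have "has_dir_deriv (\<lambda>x. \<phi> x * J1 x - \<phi>1 x * J x) b
          ((\<phi>1 x * J1 x + \<phi> x * J2 x) - (\<phi>2 x * J x + \<phi>1 x * J1 x)) x"
        by (intro has_dir_deriv_diff has_dir_deriv_mult \<phi> J True)
      then show ?thesis by (simp add: F_def[abs_def] D_def)
    next
      \<comment> \<open>Off \<open>\<Omega>\<close> nothing is known about \<open>J\<close>, but
        such an \<open>x\<close> lies in the open set \<open>- S\<close>, where \<open>F\<close> is
        identically 0.\<close>
      case False
      then have "x \<in> - S" using S \<Omega> by auto
      moreover have "has_dir_deriv (\<lambda>_. 0) b (D x) x"
        using \<phi>0[of x] \<open>x \<in> - S\<close> by (simp add: D_def has_dir_deriv_def)
      ultimately show ?thesis
        using S by (elim has_dir_deriv_transform_open[where U="- S"])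
          (auto simp: F_def \<phi>0 compact_imp_closed)
    qed
  qed
  moreover have "integral (cbox l u) D =
      integral (cbox l u) (\<lambda>x. \<phi> x * J2 x) - integral (cbox l u) (\<lambda>x. \<phi>2 x * J x)"
    unfolding D_def
    by (intro integral_diff integrable_continuous continuous_intros;
        rule continuous_on_subset[OF _ \<Omega>(2)]) (intro sub J)+
  ultimately show ?thesis by simp
qed

text \<open>The exponent is at least 2, so at the kink the difference quotient is at most
  \<open>\<bar>h\<bar> ^ Suc n\<close>, which tends to 0.\<close>

lemma DERIV_pos_part_power:
  "((\<lambda>s::real. max 0 s ^ Suc (Suc n)) has_real_derivative real (Suc (Suc n)) * max 0 s ^ Suc n) (at s)"
    (is "(?h has_real_derivative ?h' s) _")
proof -
  consider "s < 0" | "s > 0" | "s = 0" by linarith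
  then show ?thesis
  proof cases
    case 1
    have "((\<lambda>_. 0) has_real_derivative ?h' s) (at s)" using 1 by simp
    then show ?thesis 
      by (rule has_field_derivative_transform_within_open[where S="{..<0}"]) (use 1 in auto)
  next
    case 2
    have "((\<lambda>s. s ^ Suc (Suc n)) has_real_derivative ?h' s) (at s)"
      using DERIV_pow[of "Suc (Suc n)" s] 2 by (simp add: max_def)
    then show ?thesis
      by (rule has_field_derivative_transform_within_open[where S="{0<..}"]) (use 2 in \<open>auto simp: max_def\<close>)
  next
    case 3
    have "((\<lambda>h::real. max 0 h ^ Suc (Suc n) / h) \<longlongrightarrow> 0) (at 0)"
    proof (rule Lim_null_comparison[where g="\<lambda>h. \<bar>h\<bar> ^ Suc n"])
      have "norm (max 0 h ^ Suc (Suc n) / h) \<le> \<bar>h\<bar> ^ Suc n" for h :: real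
      proof (cases "h > 0")
        case False
        then have "norm (max 0 h ^ Suc (Suc n) / h) = 0" by simp
        also have "0 \<le> \<bar>h\<bar> ^ Suc n" by (intro zero_le_power abs_ge_zero)
        finally show ?thesis .
      qed (simp add: max_def)
      then show "\<forall>\<^sub>F h::real in at 0. norm (max 0 h ^ Suc (Suc n) / h) \<le> \<bar>h\<bar> ^ Suc n" by simp
      show "((\<lambda>h::real. \<bar>h\<bar> ^ Suc n) \<longlongrightarrow> 0) (at 0)"
        using tendsto_power[OF tendsto_rabs[OF tendsto_ident_at[of 0]], of "Suc n" UNIV] by simp
    qed
    then show ?thesis using 3 by (simp add: DERIV_def)
  qed
qed

section \<open>Cutoff functions and absorption\<close>

text \<open>A power of one explicit function \<eta>, instead of a smooth bump, makes the loss under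
  differentiation countable: each derivative costs exactly one factor \<eta>, which is what the
  absorption term can repay.\<close>

definition cutoff :: "'a::euclidean_space \<Rightarrow> real \<Rightarrow> nat \<Rightarrow> 'a \<Rightarrow> real" where
  "cutoff c R n x = max 0 (R\<^sup>2 - (norm (x - c))\<^sup>2) ^ n"

lemma cutoff_nonneg: "cutoff c R n x \<ge> 0"
  by (simp add: cutoff_def)

lemma cutoff_eq_0:
  assumes "x \<notin> cball c R" "0 \<le> R" "0 < n"
  shows "cutoff c R n x = 0"
proof -
  have "R\<^sup>2 < (norm (x - c))\<^sup>2"
    using assms by (intro power_strict_mono) (auto simp: dist_norm norm_minus_commute)
  then show ?thesis using assms(3) by (simp add: cutoff_def)
qed

lemma continuous_on_cutoff [continuous_intros]: "continuous_on S (cutoff c R n)"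
  unfolding cutoff_def by (intro continuous_intros)

lemma has_dir_deriv_cutoff:
  "has_dir_deriv (cutoff c R (Suc (Suc n))) b
     (- 2 * real (Suc (Suc n)) * cutoff c R (Suc n) x * ((x - c) \<bullet> b)) x"
proof -
  have "((\<lambda>s. R\<^sup>2 - (norm (x + s *\<^sub>R b - c))\<^sup>2) has_real_derivative - 2 * ((x - c) \<bullet> b)) (at 0)"
    unfolding power2_norm_eq_inner has_field_derivative_def
    by (auto intro!: derivative_eq_intros simp: inner_commute algebra_simps)
  then have "has_dir_deriv (\<lambda>x. R\<^sup>2 - (norm (x - c))\<^sup>2) b (- 2 * ((x - c) \<bullet> b)) x"
    by (simp add: has_dir_deriv_def)
  from has_dir_deriv_chain[OF DERIV_pos_part_power[of n] this] show ?thesis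
    unfolding cutoff_def[abs_def] by (simp only: mult_ac)
qed

text \<open>The index \<open>n\<close> is the exponent left after two differentiations:
  \<open>cutoff1\<close> and \<open>cutoff2\<close> are the first and second derivatives along
  \<open>b\<close> of \<open>cutoff c R (Suc (Suc n))\<close>.\<close>

definition cutoff1 :: "'a::euclidean_space \<Rightarrow> real \<Rightarrow> nat \<Rightarrow> 'a \<Rightarrow> 'a \<Rightarrow> real" where
  "cutoff1 c R n b x = - 2 * real (Suc (Suc n)) * cutoff c R (Suc n) x * ((x - c) \<bullet> b)"

definition cutoff2 :: "'a::euclidean_space \<Rightarrow> real \<Rightarrow> nat \<Rightarrow> 'a \<Rightarrow> 'a \<Rightarrow> real" where
  "cutoff2 c R n b x =
     4 * real (Suc (Suc n)) * real (Suc n) * cutoff c R n x * ((x - c) \<bullet> b)\<^sup>2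
     - 2 * real (Suc (Suc n)) * cutoff c R (Suc n) x * (b \<bullet> b)"

lemma has_dir_deriv_cutoff1:
  assumes "0 < n"
  shows "has_dir_deriv (cutoff1 c R n b) b (cutoff2 c R n b x) x"
proof -
  \<comment> \<open>The factor to be differentiated has exponent \<open>Suc n\<close>, which must be
    at least 2; hence the predecessor of \<open>n\<close>.\<close>
  obtain i where n: "n = Suc i" using assms gr0_implies_Suc by blast
  have "has_dir_deriv (\<lambda>x. (x - c) \<bullet> b) b (b \<bullet> b) x"
    unfolding has_dir_deriv_def has_field_derivative_def
    by (auto intro!: derivative_eq_intros simp: algebra_simps)
  moreover have "has_dir_deriv (\<lambda>_. - 2 * real (Suc (Suc n))) b 0 x"
    by (simp add: has_dir_deriv_def)
  ultimately show ?thesis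
    unfolding cutoff1_def[abs_def] 
    using has_dir_deriv_mult[OF has_dir_deriv_mult[OF _ has_dir_deriv_cutoff[of c R i b x]]]
    by (force simp: n cutoff2_def algebra_simps power2_eq_square)
qed

lemma continuous_on_cutoff1 [continuous_intros]: "continuous_on S (cutoff1 c R n b)"
  unfolding cutoff1_def by (intro continuous_intros)

lemma continuous_on_cutoff2 [continuous_intros]: "continuous_on S (cutoff2 c R n b)"
  unfolding cutoff2_def by (intro continuous_intros)

lemma cutoff_Suc_le: "cutoff c R (Suc n) x \<le> R\<^sup>2 * cutoff c R n x"
  unfolding cutoff_def power_Suc by (intro mult_right_mono) auto

text \<open>The sum is the Laplacian of \<open>cutoff c R (Suc (Suc n))\<close>. Inside the ball the
  coordinates of \<open>x - c\<close> are at most \<open>R\<close>, which bounds the first term of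
  each summand, and \<open>cutoff_Suc_le\<close> bounds the second; outside everything is 0.\<close>

lemma sum_cutoff2_bound:
  fixes c :: "'a::euclidean_space"
  assumes "0 < n" "0 \<le> R"
  shows "\<bar>\<Sum>b\<in>Basis. cutoff2 c R n b x\<bar> \<le>
    real DIM('a) * (4 * real (Suc (Suc n)) * real (Suc n) * R\<^sup>2 + 2 * real (Suc (Suc n)) * R\<^sup>2) * cutoff c R n x"
proof (cases "x \<in> cball c R")
  case False
  then show ?thesis
    using assms by (simp add: cutoff2_def cutoff_eq_0)
next
  case True
  have "\<bar>cutoff2 c R n b x\<bar> \<le>
    (4 * real (Suc (Suc n)) * real (Suc n) * R\<^sup>2 + 2 * real (Suc (Suc n)) * R\<^sup>2) * cutoff c R n x"
    if b: "b \<in> Basis" for b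
  proof -
    have "\<bar>(x - c) \<bullet> b\<bar> \<le> R"
      using Basis_le_norm[OF b, of "x - c"] True by (simp add: dist_norm norm_minus_commute)
    then have "((x - c) \<bullet> b)\<^sup>2 \<le> R\<^sup>2"
      using assms(2) by (simp add: abs_le_square_iff[symmetric])
    then have 1: "4 * real (Suc (Suc n)) * real (Suc n) * cutoff c R n x * ((x - c) \<bullet> b)\<^sup>2
        \<le> 4 * real (Suc (Suc n)) * real (Suc n) * cutoff c R n x * R\<^sup>2"
      by (intro mult_left_mono mult_nonneg_nonneg cutoff_nonneg) auto
    have 2: "2 * real (Suc (Suc n)) * cutoff c R (Suc n) x \<le> 2 * real (Suc (Suc n)) * (R\<^sup>2 * cutoff c R n x)"
      by (intro mult_left_mono cutoff_Suc_le) auto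
    have "0 \<le> 4 * real (Suc (Suc n)) * real (Suc n) * cutoff c R n x * ((x - c) \<bullet> b)\<^sup>2"
      "0 \<le> 2 * real (Suc (Suc n)) * cutoff c R (Suc n) x"
      by (intro mult_nonneg_nonneg cutoff_nonneg; simp)+
    with 1 2 b show ?thesis
      unfolding cutoff2_def by (simp add: algebra_simps inner_Basis abs_le_iff)
  qed
  then have "(\<Sum>b\<in>Basis. \<bar>cutoff2 c R n b x\<bar>) \<le> (\<Sum>b\<in>(Basis::'a set).
    (4 * real (Suc (Suc n)) * real (Suc n) * R\<^sup>2 + 2 * real (Suc (Suc n)) * R\<^sup>2) * cutoff c R n x)"
    by (intro sum_mono)
  then show ?thesis
    by (intro order_trans[OF sum_abs]) (simp add: mult.assoc)
qed

section \<open>Superlinear growth of the nonlinearity and absorption\<close>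

text \<open>Integration of the lower bound for \<open>f'\<close>: the function \<open>h\<close> of
  the proof is nondecreasing. Its derivative is taken only at positive points, and at 0 continuity
  is enough.\<close>

lemma power_growth_lower_bound:
  assumes deriv: "\<And>s::real. (f has_real_derivative f' s) (at s)"
    and f': "\<And>s. p * c * \<bar>s\<bar> powr (p - 1) - A \<le> f' s" and "1 < p" "0 \<le> s"
  shows "f s \<ge> c * s powr p - A * s + f 0"
proof (cases "s = 0")
  case False
  then have "0 < s" using assms by simp
  define h where "h s = f s - c * s powr p + A * s" for s
  have "continuous_on {0..s} f"
    by (rule DERIV_continuous_on[where D=f']) (rule has_field_derivative_at_within[OF deriv])
  then have "continuous_on {0..s} h"
    unfolding h_def using \<open>1 < p\<close> by (intro continuous_intros continuous_on_powr') auto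
  moreover have "\<exists>y. (h has_real_derivative y) (at x) \<and> 0 \<le> y" if "0 < x" "x < s" for x
  proof (intro exI conjI)
    show "(h has_real_derivative f' x - c * (p * x powr (p - 1)) + A) (at x)"
      unfolding h_def using that by (auto intro!: derivative_eq_intros deriv)
    show "0 \<le> f' x - c * (p * x powr (p - 1)) + A"
      using f'[of x] that by (simp add: mult_ac)
  qed
  ultimately have "h 0 \<le> h s"
    by (rule DERIV_nonneg_imp_increasing_open[OF less_imp_le[OF \<open>0 < s\<close>], rotated])
  then show ?thesis using assms by (simp add: h_def)
qed (use assms in auto)

lemma superquadratic_dominates:
  fixes a A E p :: real
  assumes "0 < a" "0 \<le> A" "0 \<le> E" "1 < p"
  obtains B where "0 \<le> B" "\<And>z. 0 \<le> z \<Longrightarrow> A * z\<^sup>2 + E * z \<le> a * z powr (p + 1) + B"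
proof -
  \<comment> \<open>Beyond the second summand \<open>a * z powr (p - 1)\<close> is at least
    \<open>A + E\<close>; the summand 1 ensures \<open>z \<le> z\<^sup>2\<close> there.\<close>
  define T where "T = 1 + ((A + E) / a) powr (1 / (p - 1))"
  have T: "1 \<le> T" by (simp add: T_def)
  show thesis
  proof
    show "0 \<le> A * T\<^sup>2 + E * T" using assms T by simp
    fix z :: real assume z: "0 \<le> z"
    show "A * z\<^sup>2 + E * z \<le> a * z powr (p + 1) + (A * T\<^sup>2 + E * T)"
    proof (cases "z \<le> T")
      case True
      then have "A * z\<^sup>2 + E * z \<le> A * T\<^sup>2 + E * T"
        using assms z by (intro add_mono mult_left_mono power_mono) auto
      moreover have "0 \<le> a * z powr (p + 1)" using assms by simp
      ultimately show ?thesis by linarith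
    next
      case False
      then have z1: "1 \<le> z" using T by linarith
      have zT: "((A + E) / a) powr (1 / (p - 1)) \<le> z" using False by (simp add: T_def)
      have "(A + E) / a = (((A + E) / a) powr (1 / (p - 1))) powr (p - 1)"
        using assms by (simp add: powr_powr)
      also have "\<dots> \<le> z powr (p - 1)"
        using assms zT by (intro powr_mono2) auto
      finally have "A + E \<le> a * z powr (p - 1)"
        using assms by (simp add: field_simps)
      then have "(A + E) * z\<^sup>2 \<le> a * z powr (p - 1) * z\<^sup>2"
        by (intro mult_right_mono) auto
      also have "\<dots> = a * z powr (p + 1)"
        using z1 by (simp add: powr_diff powr_add power2_eq_square)
      finally have "(A + E) * z\<^sup>2 \<le> a * z powr (p + 1)" .
      moreover have "E * z \<le> E * z\<^sup>2"
        using assms z1 by (intro mult_left_mono) (auto simp: power2_eq_square)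
      moreover have "0 \<le> A * T\<^sup>2 + E * T" using assms T by simp
      ultimately show ?thesis by (simp add: algebra_simps)
    qed
  qed
qed

text \<open>For \<open>z\<close> above \<open>2 * M\<close> the argument \<open>w + z\<close> is at
  least \<open>z / 2\<close>, so the growth of \<open>f\<close> becomes growth in \<open>z\<close>.
  This costs the factor \<open>2 powr p\<close>, and one further half of the main term pays for the
  linear terms and for \<open>d\<close>. For smaller \<open>z\<close> the argument stays in
  \<open>{-3*M..3*M}\<close>, where \<open>f\<close> is bounded by compactness.\<close>

lemma coercive_nonneg:
  fixes f :: "real \<Rightarrow> real"
  assumes f: "continuous_on UNIV f" "\<And>s. 0 \<le> s \<Longrightarrow> f s \<ge> c * s powr p - A * s - E"
    and "0 < c" "1 < p" "0 \<le> A" "0 \<le> E" "0 \<le> M" "0 \<le> D"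
  obtains B where "0 \<le> B" "\<And>w z d. \<bar>w\<bar> \<le> M \<Longrightarrow> \<bar>d\<bar> \<le> D \<Longrightarrow> 0 \<le> z \<Longrightarrow>
    c / 2 powr p / 2 * z powr (p + 1) - B \<le> z * (f (w + z) - d)"
proof -
  define a where "a = c / 2 powr p / 2"
  have a: "0 < a" using assms by (simp add: a_def)
  obtain B1 where B1: "0 \<le> B1" "\<And>z. 0 \<le> z \<Longrightarrow> (2 * A) * z\<^sup>2 + (E + D) * z \<le> a * z powr (p + 1) + B1"
    using superquadratic_dominates[OF a, of "2 * A" "E + D" p] assms by auto
  have "compact (f ` {-3*M..3*M})"
    using continuous_on_subset[OF f(1)] by (intro compact_continuous_image) auto
  then obtain F where F: "\<And>s. s \<in> {-3*M..3*M} \<Longrightarrow> \<bar>f s\<bar> \<le> F"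
    using compact_imp_bounded bounded_iff by (metis (no_types, lifting) image_eqI real_norm_def)
  have "0 \<le> F" using F[of 0] assms by auto
  define B where "B = B1 + 2 * M * (F + D) + a * (2 * M) powr (p + 1)"
  have "a * z powr (p + 1) - B \<le> z * (f (w + z) - d)"
    if w: "\<bar>w\<bar> \<le> M" and d: "\<bar>d\<bar> \<le> D" and z: "0 \<le> z" for w z d
  proof (cases "z \<le> 2 * M")
    case True
    have "\<bar>f (w + z)\<bar> \<le> F" using w z True by (intro F) auto
    then have "- (F + D) \<le> f (w + z) - d" using d by auto
    then have "z * (- (F + D)) \<le> z * (f (w + z) - d)" using z by (intro mult_left_mono)
    then have "- (z * (F + D)) \<le> z * (f (w + z) - d)" by (simp only: mult_minus_right)
    moreover have "z * (F + D) \<le> 2 * M * (F + D)"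
      using True \<open>0 \<le> F\<close> assms by (intro mult_right_mono) auto
    moreover have "a * z powr (p + 1) \<le> a * (2 * M) powr (p + 1)"
      using True a z assms by (intro mult_left_mono powr_mono2) auto
    ultimately show ?thesis unfolding B_def using B1(1) by linarith
  next
    case False
    have s: "z / 2 \<le> w + z" "w + z \<le> 2 * z" using False w by auto
    have "c * (z / 2) powr p \<le> c * (w + z) powr p"
      using assms s z by (intro mult_left_mono powr_mono2) auto
    moreover have "A * (w + z) \<le> A * (2 * z)" using s assms by (intro mult_left_mono) auto
    ultimately have "f (w + z) - d \<ge> c * (z / 2) powr p - 2 * A * z - (E + D)"
      using f(2)[of "w + z"] s z d by auto
    then have "z * (c * (z / 2) powr p - 2 * A * z - (E + D)) \<le> z * (f (w + z) - d)"
      using z by (intro mult_left_mono)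
    moreover have "z * (c * (z / 2) powr p) = 2 * a * z powr (p + 1)"
      using z False assms by (simp add: a_def powr_divide powr_add)
    moreover have "0 \<le> 2 * M * (F + D) + a * (2 * M) powr (p + 1)"
      using assms a \<open>0 \<le> F\<close> by simp
    ultimately show ?thesis using B1(2)[OF z] by (simp add: B_def algebra_simps power2_eq_square)
  qed
  moreover have "0 \<le> B"
    using B1(1) assms a \<open>0 \<le> F\<close> by (simp add: B_def)
  ultimately show thesis using that unfolding a_def by blast
qed

text \<open>In the application \<open>z\<close> is the difference of the solution and
  \<open>w\<close>, and \<open>d\<close> is the Laplacian of \<open>w\<close>. Negative
  \<open>z\<close> reduce to positive ones through the reflection \<open>g s = - f (- s)\<close>,
  which obeys the same lower bound on its derivative.\<close>

lemma power_growth_coercive: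
  assumes f: "power_growth p c C A0 A1 f" and pos: "0 < c" "1 < p" "0 \<le> A0" "0 \<le> M" "0 \<le> D"
  obtains a B where "0 < a" "0 \<le> B" "\<And>w z d. \<bar>w\<bar> \<le> M \<Longrightarrow> \<bar>d\<bar> \<le> D \<Longrightarrow>
    a * \<bar>z\<bar> powr (p + 1) - B \<le> z * (f (w + z) - d)"
proof -
  have "f differentiable (at s)" for s
    using f C1_differentiable_imp_continuous_on unfolding power_growth_def C1_differentiable_on_eq by blast
  then have deriv: "(f has_real_derivative deriv f s) (at s)" for s
    by (simp add: DERIV_deriv_iff_real_differentiable)
  have cont: "continuous_on UNIV f"
    by (intro continuous_at_imp_continuous_on ballI DERIV_isCont[OF deriv])
  define g where "g s = - f (- s)" for s
  have derivg: "(g has_real_derivative deriv f (- s)) (at s)" for s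
    unfolding g_def by (auto intro!: derivative_eq_intros DERIV_chain2[OF deriv])
  have contg: "continuous_on UNIV g"
    by (intro continuous_at_imp_continuous_on ballI DERIV_isCont[OF derivg])
  have lower: "deriv f s \<ge> p * c * \<bar>s\<bar> powr (p - 1) - A0" for s
    using f unfolding power_growth_def by blast
  have "c * s powr p - A0 * s - \<bar>f 0\<bar> \<le> f s" if "0 \<le> s" for s
    using power_growth_lower_bound[OF deriv lower \<open>1 < p\<close> that] by linarith
  then obtain B where B: "0 \<le> B" "\<And>w z d. \<bar>w\<bar> \<le> M \<Longrightarrow> \<bar>d\<bar> \<le> D \<Longrightarrow> 0 \<le> z \<Longrightarrow>
    c / 2 powr p / 2 * z powr (p + 1) - B \<le> z * (f (w + z) - d)"
    using coercive_nonneg[OF cont, of c p A0 "\<bar>f 0\<bar>" M D] pos by auto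
  have "p * c * \<bar>s\<bar> powr (p - 1) - A0 \<le> deriv f (- s)" for s
    using lower[of "- s"] by simp
  from power_growth_lower_bound[OF derivg this \<open>1 < p\<close>]
  have "c * s powr p - A0 * s - \<bar>f 0\<bar> \<le> g s" if "0 \<le> s" for s
    using that by (fastforce simp: g_def)
  then obtain B' where B': "0 \<le> B'" "\<And>w z d. \<bar>w\<bar> \<le> M \<Longrightarrow> \<bar>d\<bar> \<le> D \<Longrightarrow> 0 \<le> z \<Longrightarrow>
    c / 2 powr p / 2 * z powr (p + 1) - B' \<le> z * (g (w + z) - d)"
    using coercive_nonneg[OF contg, of c p A0 "\<bar>f 0\<bar>" M D] pos by auto
  show thesis
  proof
    show "0 < c / 2 powr p / 2" "0 \<le> max B B'" using pos B by auto
    fix w z d :: real assume *: "\<bar>w\<bar> \<le> M" "\<bar>d\<bar> \<le> D"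
    show "c / 2 powr p / 2 * \<bar>z\<bar> powr (p + 1) - max B B' \<le> z * (f (w + z) - d)"
    proof (cases "0 \<le> z")
      case True
      then show ?thesis using B(2)[OF * True] by simp
    next
      case False
      then have "c / 2 powr p / 2 * (- z) powr (p + 1) - B' \<le> (- z) * (g (- w + - z) - (- d))"
        using * by (intro B'(2)) auto
      also have "\<dots> = z * (f (w + z) - d)" by (simp add: g_def algebra_simps)
      finally show ?thesis using False by simp
    qed
  qed
qed

text \<open>The factor \<open>\<eta>\<^sup>2 Y powr ((p - 1) / 2)\<close> either is large, and the absorption term wins, or it is
  bounded, and then so is \<open>\<eta> ^ (2 * k) * Y powr (r / 2)\<close>.\<close>

lemma absorption_bound:
  fixes r p a B C0 \<delta> R :: real and k :: nat
  assumes "0 < r" "1 < p" "0 < a" "0 \<le> B" "0 \<le> C0" "0 < \<delta>" "0 \<le> R" and k: "r \<le> real k * (p - 1)"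
  obtains C where "0 \<le> C" "\<And>\<eta> Y. 0 \<le> \<eta> \<Longrightarrow> \<eta> \<le> R \<Longrightarrow> \<delta> \<le> Y \<Longrightarrow>
    C0 * \<eta> ^ (2 * k) * Y powr (r / 2) + \<eta> ^ (2 * k + 2) * (r * Y powr (r / 2 - 1) * (B - a * Y powr ((p + 1) / 2))) \<le> C"
proof -
  \<comment> \<open>\<open>C1\<close> merges the diffusion coefficient \<open>C0\<close> with the
    constant \<open>B\<close>, by means of \<open>\<eta> \<le> R\<close> and
    \<open>\<delta> \<le> Y\<close>.\<close>
  define C1 where "C1 = C0 + r * R\<^sup>2 * B / \<delta>"
  have C1: "0 \<le> C1" using assms by (simp add: C1_def)
  \<comment> \<open>The value of \<open>\<eta>\<^sup>2 * X\<close> at which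
    \<open>C1 - r * a * (\<eta>\<^sup>2 * X)\<close> changes sign.\<close>
  define T where "T = C1 / (r * a)"
  have T: "0 \<le> T" using C1 assms by (simp add: T_def)
  show thesis
  proof
    show "0 \<le> C1 * (R ^ (2 * k) + T ^ k)" using C1 T assms by simp
    fix \<eta> Y :: real assume \<eta>: "0 \<le> \<eta>" "\<eta> \<le> R" and Y: "\<delta> \<le> Y"
    then have Y0: "0 < Y" using assms by simp
    define X where "X = Y powr ((p - 1) / 2)"
    have X: "0 < X" using Y0 by (simp add: X_def)
    have YX: "Y powr ((p + 1) / 2) = X * Y"
      using Y0 powr_add[of Y "(p - 1) / 2" 1] by (simp add: X_def field_simps)
    define W where "W = Y powr (r / 2 - 1)"
    have YW: "Y powr (r / 2) = W * Y"
      using Y0 powr_add[of Y "r / 2 - 1" 1] by (simp add: W_def)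
    have "\<eta>\<^sup>2 * B / Y \<le> R\<^sup>2 * B / \<delta>"
      using assms \<eta> Y by (intro frac_le mult_right_mono power_mono mult_nonneg_nonneg) auto
    then have "r * (\<eta>\<^sup>2 * B / Y) \<le> r * (R\<^sup>2 * B / \<delta>)" using assms by (intro mult_left_mono) auto
    then have le: "C0 + r * \<eta>\<^sup>2 * (B / Y - a * X) \<le> C1 - r * a * (\<eta>\<^sup>2 * X)"
      by (simp add: C1_def algebra_simps)
    have "C0 * \<eta> ^ (2 * k) * Y powr (r / 2) + \<eta> ^ (2 * k + 2) * (r * Y powr (r / 2 - 1) * (B - a * Y powr ((p + 1) / 2)))
      = \<eta> ^ (2 * k) * Y powr (r / 2) * (C0 + r * \<eta>\<^sup>2 * (B / Y - a * X))"
      using Y0 unfolding YX YW W_def[symmetric] by (simp add: power_add field_simps power2_eq_square)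
    also have "\<dots> \<le> \<eta> ^ (2 * k) * Y powr (r / 2) * (C1 - r * a * (\<eta>\<^sup>2 * X))"
      using le \<eta> by (intro mult_left_mono) auto
    also have "\<dots> \<le> C1 * (R ^ (2 * k) + T ^ k)"
    proof (cases "C1 \<le> r * a * (\<eta>\<^sup>2 * X)")
      case True
      then have "\<eta> ^ (2 * k) * Y powr (r / 2) * (C1 - r * a * (\<eta>\<^sup>2 * X)) \<le> 0"
        using \<eta> by (intro mult_nonneg_nonpos) auto
      also have "0 \<le> C1 * (R ^ (2 * k) + T ^ k)" using C1 T assms by simp
      finally show ?thesis .
    next
      case False
      then have small: "\<eta>\<^sup>2 * X \<le> T" using assms by (simp add: T_def field_simps)
      \<comment> \<open>Here the size of \<open>k\<close> enters: with
        \<open>r \<le> real k * (p - 1)\<close> the power of \<open>Y\<close> is controlled by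
        \<open>X ^ k\<close>, and the \<open>2 * k\<close> factors \<eta> combine with it to
        \<open>(\<eta>\<^sup>2 * X) ^ k\<close>, at most \<open>T ^ k\<close>.\<close>
      have "Y powr (r / 2) \<le> 1 + X ^ k"
      proof (cases "Y \<le> 1")
        case True
        then have "Y powr (r / 2) \<le> 1 powr (r / 2)" using Y0 assms by (intro powr_mono2) auto
        moreover have "0 \<le> X ^ k" using X by simp
        ultimately show ?thesis by simp
      next
        case False
        then have "Y powr (r / 2) \<le> Y powr (real k * (p - 1) / 2)"
          using k by (intro powr_mono) auto
        also have "\<dots> = X ^ k" using Y0 by (simp add: X_def powr_powr powr_realpow[symmetric] mult.commute)
        finally show ?thesis by simp
      qed
      then have "\<eta> ^ (2 * k) * Y powr (r / 2) \<le> \<eta> ^ (2 * k) * (1 + X ^ k)"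
        using \<eta> by (intro mult_left_mono) auto
      also have "\<dots> = \<eta> ^ (2 * k) + (\<eta>\<^sup>2 * X) ^ k"
        by (simp only: power_mult power_mult_distrib distrib_left mult_1_right)
      also have "\<dots> \<le> R ^ (2 * k) + T ^ k"
        using \<eta> small X by (intro add_mono power_mono) auto
      finally have bd: "\<eta> ^ (2 * k) * Y powr (r / 2) \<le> R ^ (2 * k) + T ^ k" .
      have "0 \<le> r * a * (\<eta>\<^sup>2 * X)" using X assms by simp
      then have "\<eta> ^ (2 * k) * Y powr (r / 2) * (C1 - r * a * (\<eta>\<^sup>2 * X)) \<le> (R ^ (2 * k) + T ^ k) * C1"
        using False T assms by (intro mult_mono[OF bd]) (linarith, simp_all)
      then show ?thesis unfolding mult.commute[of C1 "R ^ (2 * k) + T ^ k"] .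
    qed
    finally show "C0 * \<eta> ^ (2 * k) * Y powr (r / 2) + \<eta> ^ (2 * k + 2) * (r * Y powr (r / 2 - 1) * (B - a * Y powr ((p + 1) / 2))) \<le> C1 * (R ^ (2 * k) + T ^ k)" .
  qed
qed

section \<open>Polynomial comparison functions and the regularised power\<close>

text \<open>The derivative is again a polynomial, so the lemma can be iterated and all second
  derivatives of the comparison function are continuous.\<close>

lemma real_polynomial_function_dir_deriv:
  fixes w :: "'a::real_normed_vector \<Rightarrow> real"
  assumes "real_polynomial_function w"
  obtains w' where "real_polynomial_function w'" "\<And>x. has_dir_deriv w b (w' x) x"
proof -
  have "\<exists>w'. real_polynomial_function w' \<and> (\<forall>x. has_dir_deriv w b (w' x) x)"
    using assms
  proof induction
    case (linear f)
    have "has_dir_deriv f b (f b) x" for x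
      by (intro has_derivative_imp_has_dir_deriv bounded_linear.has_derivative[OF linear] derivative_eq_intros refl)
    then show ?case by blast
  next
    case (const c)
    have "has_dir_deriv (\<lambda>_. c) b 0 x" for x by (simp add: has_dir_deriv_def)
    then show ?case by blast
  next
    case (add f g)
    then obtain f' g' where "real_polynomial_function f'" "\<And>x. has_dir_deriv f b (f' x) x"
      "real_polynomial_function g'" "\<And>x. has_dir_deriv g b (g' x) x"
      by blast
    moreover from this have "has_dir_deriv (\<lambda>x. f x + g x) b (f' x + g' x) x" for x
      unfolding has_dir_deriv_def by (intro DERIV_add)
    ultimately show ?case by blast
  next
    case (mult f g)
    then obtain f' g' where *: "real_polynomial_function f'" "\<And>x. has_dir_deriv f b (f' x) x"
      "real_polynomial_function g'" "\<And>x. has_dir_deriv g b (g' x) x"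
      by blast
    then have "has_dir_deriv (\<lambda>x. f x * g x) b (f' x * g x + f x * g' x) x" for x
      by (intro has_dir_deriv_mult)
    moreover have "real_polynomial_function (\<lambda>x. f' x * g x + f x * g' x)"
      by (intro real_polynomial_function.intros(3,4) * mult.hyps)
    ultimately show ?case by blast
  qed
  then show thesis using that by blast
qed

lemma continuous_on_real_polynomial_function:
  fixes w :: "'a::real_normed_vector \<Rightarrow> real"
  shows "real_polynomial_function w \<Longrightarrow> continuous_on S w"
  by (simp add: continuous_on_polymonial_function real_polynomial_function_eq)

lemma has_dir_deriv_partial:
  "F differentiable (at x) \<Longrightarrow> has_dir_deriv F b (partial b F x) x"
  unfolding partial_def
  by (rule has_derivative_imp_has_dir_deriv) (simp add: frechet_derivative_works[symmetric])

text \<open>A smooth substitute for \<open>\<bar>y\<bar> powr r\<close>, whose second derivative is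
  singular at 0 for \<open>1 < r\<close> and \<open>r < 2\<close>; it is convex for
  \<open>r \<ge> 1\<close>.\<close>

definition reg_power :: "real \<Rightarrow> real \<Rightarrow> real \<Rightarrow> real" where
  "reg_power \<delta> r y = (\<delta> + y\<^sup>2) powr (r / 2)"

definition reg_power' :: "real \<Rightarrow> real \<Rightarrow> real \<Rightarrow> real" where
  "reg_power' \<delta> r y = r * y * (\<delta> + y\<^sup>2) powr (r / 2 - 1)"

definition reg_power'' :: "real \<Rightarrow> real \<Rightarrow> real \<Rightarrow> real" where
  "reg_power'' \<delta> r y = r * (\<delta> + (r - 1) * y\<^sup>2) * (\<delta> + y\<^sup>2) powr (r / 2 - 2)"

lemma DERIV_reg_power:
  assumes "0 < \<delta>"
  shows "(reg_power \<delta> r has_real_derivative reg_power' \<delta> r y) (at y)"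
proof -
  have "0 < \<delta> + y\<^sup>2" using assms by (simp add: add_pos_nonneg)
  then show ?thesis
    unfolding reg_power_def[abs_def] reg_power'_def
    by (auto intro!: derivative_eq_intros)
qed

text \<open>Factoring out the power with exponent \<open>r / 2 - 2\<close> leaves
  \<open>\<delta> + (r - 1) * y\<^sup>2\<close>, a form in which the sign is visible.\<close>

lemma DERIV_reg_power':
  assumes "0 < \<delta>"
  shows "(reg_power' \<delta> r has_real_derivative reg_power'' \<delta> r y) (at y)"
proof -
  have pos: "0 < \<delta> + y\<^sup>2" using assms by (simp add: add_pos_nonneg)
  have "(\<delta> + y\<^sup>2) powr (r / 2 - 1) = (\<delta> + y\<^sup>2) powr (r / 2 - 2) * (\<delta> + y\<^sup>2)"
    using pos powr_add[of "\<delta> + y\<^sup>2" "r / 2 - 2" 1] by simp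
  moreover have "(reg_power' \<delta> r has_real_derivative
      r * (\<delta> + y\<^sup>2) powr (r / 2 - 1) + r * y * ((r / 2 - 1) * (\<delta> + y\<^sup>2) powr (r / 2 - 2) * (2 * y))) (at y)"
    unfolding reg_power'_def[abs_def] using pos
    by (auto intro!: derivative_eq_intros simp: field_simps)
  ultimately show ?thesis
    by (simp add: reg_power''_def algebra_simps power2_eq_square)
qed

lemma reg_power''_nonneg: "0 < \<delta> \<Longrightarrow> 1 \<le> r \<Longrightarrow> 0 \<le> reg_power'' \<delta> r y"
  by (simp add: reg_power''_def)

lemma continuous_on_reg_power [continuous_intros]:
  assumes "0 < \<delta>" "continuous_on S h"
  shows "continuous_on S (\<lambda>x. reg_power \<delta> r (h x))"
    "continuous_on S (\<lambda>x. reg_power' \<delta> r (h x))"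
    "continuous_on S (\<lambda>x. reg_power'' \<delta> r (h x))"
  using assms(1) add_pos_nonneg[OF assms(1), THEN less_imp_neq[THEN not_sym], of "(h _)\<^sup>2"]
  unfolding reg_power_def reg_power'_def reg_power''_def
  by (auto intro!: continuous_intros assms(2))

text \<open>Convexity of \<open>reg_power \<delta> r\<close> is what makes the gradient term drop out.\<close>

lemma integral_Kato_inequality:
  fixes \<phi> \<phi>1 \<phi>2 z z1 z2 :: "'a::euclidean_space \<Rightarrow> real"
  assumes \<delta>: "0 < \<delta>" "1 \<le> r"
    and \<Omega>: "open \<Omega>" "cbox l u \<subseteq> \<Omega>" and S: "compact S" "S \<subseteq> cbox l u"
    and \<phi>: "\<And>x. has_dir_deriv \<phi> b (\<phi>1 x) x" "\<And>x. has_dir_deriv \<phi>1 b (\<phi>2 x) x"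
      "continuous_on UNIV \<phi>" "continuous_on UNIV \<phi>1" "continuous_on UNIV \<phi>2"
    and \<phi>0: "\<And>x. x \<notin> S \<Longrightarrow> \<phi> x = 0 \<and> \<phi>1 x = 0 \<and> \<phi>2 x = 0" and \<phi>_nonneg: "\<And>x. 0 \<le> \<phi> x"
    and z: "\<And>x. x \<in> \<Omega> \<Longrightarrow> has_dir_deriv z b (z1 x) x" "\<And>x. x \<in> \<Omega> \<Longrightarrow> has_dir_deriv z1 b (z2 x) x"
      "continuous_on \<Omega> z" "continuous_on \<Omega> z1" "continuous_on \<Omega> z2"
  shows "integral (cbox l u) (\<lambda>x. \<phi> x * (reg_power' \<delta> r (z x) * z2 x)) \<le>
    integral (cbox l u) (\<lambda>x. \<phi>2 x * reg_power \<delta> r (z x))"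
proof -
  note cont = continuous_on_reg_power[OF \<delta>(1) z(3)]
  have "continuous_on \<Omega> \<phi>" using \<phi>(3) continuous_on_subset by blast
  note int = integrable_continuous[OF continuous_on_subset[OF _ \<Omega>(2)]]
  \<comment> \<open>The larger integrand is \<open>\<phi>\<close> times the full second derivative
    of \<open>reg_power \<delta> r (z x)\<close> along \<open>b\<close>, so the double integration
    by parts applies to it.\<close>
  have "integral (cbox l u) (\<lambda>x. \<phi> x * (reg_power' \<delta> r (z x) * z2 x)) \<le>
    integral (cbox l u) (\<lambda>x. \<phi> x * ((reg_power'' \<delta> r (z x) * z1 x) * z1 x + reg_power' \<delta> r (z x) * z2 x))"
  proof (rule integral_le)
    fix x
    have "0 \<le> (reg_power'' \<delta> r (z x) * z1 x) * z1 x"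
      using reg_power''_nonneg[OF \<delta>, of "z x"] by (simp add: mult.assoc)
    then show "\<phi> x * (reg_power' \<delta> r (z x) * z2 x) \<le>
        \<phi> x * ((reg_power'' \<delta> r (z x) * z1 x) * z1 x + reg_power' \<delta> r (z x) * z2 x)"
      by (intro mult_left_mono \<phi>_nonneg) simp
  qed (intro int continuous_intros cont z \<open>continuous_on \<Omega> \<phi>\<close>)+
  also have "\<dots> = integral (cbox l u) (\<lambda>x. \<phi>2 x * reg_power \<delta> r (z x))"
  proof (rule integral_by_parts_twice[OF \<Omega> S \<phi> \<phi>0])
    fix x assume x: "x \<in> \<Omega>"
    show "has_dir_deriv (\<lambda>x. reg_power \<delta> r (z x)) b (reg_power' \<delta> r (z x) * z1 x) x"
      by (intro has_dir_deriv_chain DERIV_reg_power \<delta> z x)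
    show "has_dir_deriv (\<lambda>x. reg_power' \<delta> r (z x) * z1 x) b
        ((reg_power'' \<delta> r (z x) * z1 x) * z1 x + reg_power' \<delta> r (z x) * z2 x) x"
      by (intro has_dir_deriv_mult has_dir_deriv_chain[where h="reg_power' \<delta> r"] DERIV_reg_power' \<delta> z x)
  qed (intro continuous_intros cont z | assumption)+
  finally show ?thesis .
qed

text \<open>The sum is at most twice the larger of \<open>\<delta>\<close> and
  \<open>z\<^sup>2\<close>. This rewrites coercivity in terms of
  \<open>\<delta> + z\<^sup>2\<close>, the variable \<open>Y\<close> of
  \<open>absorption_bound\<close>.\<close>

lemma powr_sum_squares_le:
  fixes \<delta> z p :: real
  assumes "0 < \<delta>" "0 \<le> p"
  shows "(\<delta> + z\<^sup>2) powr ((p + 1) / 2) \<le> (2 * \<delta>) powr ((p + 1) / 2) + 2 powr ((p + 1) / 2) * \<bar>z\<bar> powr (p + 1)"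
proof (cases "z\<^sup>2 \<le> \<delta>")
  case True
  then have "(\<delta> + z\<^sup>2) powr ((p + 1) / 2) \<le> (2 * \<delta>) powr ((p + 1) / 2)"
    using assms by (intro powr_mono2) auto
  moreover have "0 \<le> 2 powr ((p + 1) / 2) * \<bar>z\<bar> powr (p + 1)" by simp
  ultimately show ?thesis by linarith
next
  case False
  then have "(\<delta> + z\<^sup>2) powr ((p + 1) / 2) \<le> (2 * \<bar>z\<bar>\<^sup>2) powr ((p + 1) / 2)"
    using assms by (intro powr_mono2) auto
  also have "\<dots> = 2 powr ((p + 1) / 2) * (\<bar>z\<bar>\<^sup>2) powr ((p + 1) / 2)"
    by (intro powr_mult)
  also have "(\<bar>z\<bar>\<^sup>2) powr ((p + 1) / 2) = \<bar>z\<bar> powr (p + 1)"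
    using powr_powr[of "\<bar>z\<bar>" 2 "(p + 1) / 2"] by (simp add: add_divide_distrib)
  finally show ?thesis using powr_ge_zero[of "2 * \<delta>" "(p + 1) / 2"] by linarith
qed

text \<open>The left side is what remains under the integral in the time derivative of the energy
  after the Laplacian has been moved onto the cutoff. The bound is pointwise and asks nothing of
  \<open>z\<close>, so one \<open>B\<close> serves all solutions.\<close>

lemma absorption_estimate:
  fixes c0 :: "'a::euclidean_space"
  assumes f: "power_growth p c C A0 A1 f" and pos: "0 < c" "1 < p" "0 \<le> A0" "0 \<le> M" "0 \<le> D"
    and \<delta>: "0 < \<delta>" and r: "1 \<le> r" and R: "0 \<le> R" and k: "0 < k" "r \<le> real k * (p - 1)"
  obtains B where "\<And>x w z d. \<bar>w\<bar> \<le> M \<Longrightarrow> \<bar>d\<bar> \<le> D \<Longrightarrow>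
    (\<Sum>b\<in>Basis. cutoff2 c0 R (2 * k) b x) * reg_power \<delta> r z +
      cutoff c0 R (Suc (Suc (2 * k))) x * (reg_power' \<delta> r z * (d - f (w + z))) \<le> B"
proof -
  obtain a B where a: "0 < a" and B: "0 \<le> B" and coer: "\<And>w z d. \<bar>w\<bar> \<le> M \<Longrightarrow> \<bar>d\<bar> \<le> D \<Longrightarrow>
      a * \<bar>z\<bar> powr (p + 1) - B \<le> z * (f (w + z) - d)"
    by (rule power_growth_coercive[OF f pos]) blast
  define q where "q = (p + 1) / 2"
  \<comment> \<open>Passing from \<open>\<bar>z\<bar> powr (p + 1)\<close> to
    \<open>(\<delta> + z\<^sup>2) powr q\<close> costs the factor \<open>2 powr q\<close> and an
    additive constant, which goes into \<open>B'\<close>.\<close>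
  define a' where "a' = a / 2 powr q"
  define B' where "B' = B + a' * (2 * \<delta>) powr q"
  have a': "0 < a'" "0 \<le> B'" using a B by (auto simp: a'_def B'_def)
  have coer': "z * (d - f (w + z)) \<le> B' - a' * (\<delta> + z\<^sup>2) powr q"
    if "\<bar>w\<bar> \<le> M" "\<bar>d\<bar> \<le> D" for w z d
  proof -
    have "a' * (\<delta> + z\<^sup>2) powr q \<le> a' * ((2 * \<delta>) powr q + 2 powr q * \<bar>z\<bar> powr (p + 1))"
      unfolding q_def using a' \<delta> pos by (intro mult_left_mono powr_sum_squares_le) auto
    also have "\<dots> = a' * (2 * \<delta>) powr q + a * \<bar>z\<bar> powr (p + 1)"
      by (simp add: a'_def field_simps)
    finally show ?thesis
      using coer[OF that, of z] by (simp add: B'_def algebra_simps)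
  qed
  define C0 where "C0 = real DIM('a) *
    (4 * real (Suc (Suc (2 * k))) * real (Suc (2 * k)) * R\<^sup>2 + 2 * real (Suc (Suc (2 * k))) * R\<^sup>2)"
  have C0: "0 \<le> C0" by (simp add: C0_def)
  \<comment> \<open>The base of the cutoff ranges up to \<open>R\<^sup>2\<close>, which therefore
    replaces the bound \<open>R\<close> of \<open>absorption_bound\<close>.\<close>
  obtain K where K: "\<And>\<eta> Y. 0 \<le> \<eta> \<Longrightarrow> \<eta> \<le> R\<^sup>2 \<Longrightarrow> \<delta> \<le> Y \<Longrightarrow>
      C0 * \<eta> ^ (2 * k) * Y powr (r / 2) +
        \<eta> ^ (2 * k + 2) * (r * Y powr (r / 2 - 1) * (B' - a' * Y powr ((p + 1) / 2))) \<le> K"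
    by (rule absorption_bound[OF less_le_trans[OF zero_less_one r] pos(2) a' C0 \<delta> zero_le_power2 k(2)]) blast
  show thesis
  proof
    fix x :: 'a and w z d :: real assume wd: "\<bar>w\<bar> \<le> M" "\<bar>d\<bar> \<le> D"
    define \<eta> where "\<eta> = max 0 (R\<^sup>2 - (norm (x - c0))\<^sup>2)"
    have \<eta>: "0 \<le> \<eta>" "\<eta> \<le> R\<^sup>2" by (auto simp: \<eta>_def)
    define Y where "Y = \<delta> + z\<^sup>2"
    have Y: "\<delta> \<le> Y" by (simp add: Y_def)
    have cut: "cutoff c0 R n x = \<eta> ^ n" for n by (simp add: cutoff_def \<eta>_def)
    have "(\<Sum>b\<in>Basis. cutoff2 c0 R (2 * k) b x) \<le> C0 * \<eta> ^ (2 * k)"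
      using sum_cutoff2_bound[of "2 * k" R c0 x] k R unfolding C0_def cut by (simp add: abs_le_iff)
    then have 1: "(\<Sum>b\<in>Basis. cutoff2 c0 R (2 * k) b x) * reg_power \<delta> r z \<le> C0 * \<eta> ^ (2 * k) * Y powr (r / 2)"
      unfolding reg_power_def Y_def by (intro mult_right_mono) auto
    have "reg_power' \<delta> r z * (d - f (w + z)) = r * Y powr (r / 2 - 1) * (z * (d - f (w + z)))"
      by (simp add: reg_power'_def Y_def)
    also have "\<dots> \<le> r * Y powr (r / 2 - 1) * (B' - a' * Y powr ((p + 1) / 2))"
      using coer'[OF wd, of z] r unfolding q_def Y_def by (intro mult_left_mono) auto
    finally have "cutoff c0 R (Suc (Suc (2 * k))) x * (reg_power' \<delta> r z * (d - f (w + z))) \<le>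
      \<eta> ^ (2 * k + 2) * (r * Y powr (r / 2 - 1) * (B' - a' * Y powr ((p + 1) / 2)))"
      using \<eta> unfolding cut by (simp only: add_2_eq_Suc') (intro mult_left_mono zero_le_power)
    with 1 K[OF \<eta> Y] show "(\<Sum>b\<in>Basis. cutoff2 c0 R (2 * k) b x) * reg_power \<delta> r z +
      cutoff c0 R (Suc (Suc (2 * k))) x * (reg_power' \<delta> r z * (d - f (w + z))) \<le> K"
      by linarith
  qed
qed

section \<open>The interior energy inequality\<close>

lemma power_growth_continuous:
  assumes "power_growth p c C A0 A1 f"
  shows "continuous_on S f"
proof -
  have "f differentiable (at s)" for s
    using assms unfolding power_growth_def C1_differentiable_on_eq by blast
  then show ?thesis
    by (intro continuous_at_imp_continuous_on) (simp add: differentiable_imp_continuous_within)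
qed

lemma continuous_on_cbox_bounded:
  fixes h :: "'a::euclidean_space \<Rightarrow> real"
  assumes "continuous_on (cbox l u) h"
  obtains M where "0 \<le> M" "\<And>x. x \<in> cbox l u \<Longrightarrow> \<bar>h x\<bar> \<le> M"
proof -
  have "bounded (h ` cbox l u)"
    using assms by (intro compact_imp_bounded compact_continuous_image) auto
  then show thesis
    using that unfolding bounded_pos by (metis image_eqI less_imp_le real_norm_def)
qed

lemma classical_solution_continuous_on:
  assumes "classical_solution \<Omega> f g v" and Q: "Q \<subseteq> \<Omega>"
  shows "continuous_on ({0<..} \<times> Q) (\<lambda>y. v (fst y) (snd y))"
    "continuous_on ({0<..} \<times> Q) (\<lambda>y. deriv (\<lambda>s. v s (snd y)) (fst y))"
proof -
  have sub: "{0<..} \<times> Q \<subseteq> {0<..} \<times> closure \<Omega>" "{0<..} \<times> Q \<subseteq> {0<..} \<times> \<Omega>"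
    using Q closure_subset by blast+
  have c: "continuous_on ({0<..} \<times> closure \<Omega>) (\<lambda>y. v (fst y) (snd y))"
    "continuous_on ({0<..} \<times> \<Omega>) (\<lambda>y. deriv (\<lambda>s. v s (snd y)) (fst y))"
    using assms(1) by (simp_all add: classical_solution_def split_beta)
  show "continuous_on ({0<..} \<times> Q) (\<lambda>y. v (fst y) (snd y))"
    by (rule continuous_on_subset[OF c(1) sub(1)])
  show "continuous_on ({0<..} \<times> Q) (\<lambda>y. deriv (\<lambda>s. v s (snd y)) (fst y))"
    by (rule continuous_on_subset[OF c(2) sub(2)])
qed

lemma classical_solution_partials:
  assumes cs: "classical_solution \<Omega> f g v" and t: "0 < t" and b: "b \<in> Basis"
  shows "x \<in> \<Omega> \<Longrightarrow> has_dir_deriv (v t) b (partial b (v t) x) x"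
    "x \<in> \<Omega> \<Longrightarrow> has_dir_deriv (partial b (v t)) b (partial b (partial b (v t)) x) x"
    "continuous_on \<Omega> (v t)" "continuous_on \<Omega> (partial b (v t))"
    "continuous_on \<Omega> (partial b (partial b (v t)))"
proof -
  have "Ck_on 2 \<Omega> (v t)" using cs t by (simp add: classical_solution_def)
  then have d: "\<And>x. x \<in> \<Omega> \<Longrightarrow> v t differentiable (at x)"
    "\<And>x. x \<in> \<Omega> \<Longrightarrow> partial b (v t) differentiable (at x)"
    and c: "continuous_on \<Omega> (partial b (partial b (v t)))"
    using b by (auto simp: numeral_2_eq_2)
  show "x \<in> \<Omega> \<Longrightarrow> has_dir_deriv (v t) b (partial b (v t) x) x"
    "x \<in> \<Omega> \<Longrightarrow> has_dir_deriv (partial b (v t)) b (partial b (partial b (v t)) x) x"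
    using d by (auto intro: has_dir_deriv_partial)
  show "continuous_on \<Omega> (v t)" "continuous_on \<Omega> (partial b (v t))"
    using d by (auto intro!: continuous_at_imp_continuous_on differentiable_imp_continuous_within)
  show "continuous_on \<Omega> (partial b (partial b (v t)))" by (rule c)
qed

text \<open>\<open>K\<close> is produced before \<open>g\<close>, \<open>v\<close>, \<open>s\<close>
  and \<open>t\<close> are named; this order of quantifiers is the uniformity in the approximations.
  It is possible because the cutoff keeps every integral away from the boundary, where
  \<open>g\<close> acts.\<close>

lemma energy_inequality:
  fixes \<Omega> :: "'a::euclidean_space set"
  assumes \<Omega>: "open \<Omega>" "cbox l u \<subseteq> \<Omega>" and ball: "cball c0 R \<subseteq> cbox l u"
    and f: "power_growth p c C A0 A1 f" and pos: "0 < c" "1 < p" "0 \<le> A0"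
    and \<delta>: "0 < \<delta>" and r: "1 \<le> r" and R: "0 \<le> R" and k: "0 < k" "r \<le> real k * (p - 1)"
    and w: "real_polynomial_function w"
  obtains K where "\<And>g v s t. classical_solution \<Omega> f g v \<Longrightarrow> 0 < s \<Longrightarrow> s \<le> t \<Longrightarrow>
    integral (cbox l u) (\<lambda>x. cutoff c0 R (Suc (Suc (2 * k))) x * reg_power \<delta> r (v t x - w x)) \<le>
    integral (cbox l u) (\<lambda>x. cutoff c0 R (Suc (Suc (2 * k))) x * reg_power \<delta> r (v s x - w x)) + K * (t - s)"
proof -
  define Q where "Q = cbox l u"
  define \<phi> where "\<phi> = cutoff c0 R (Suc (Suc (2 * k)))"
  define \<phi>2 where "\<phi>2 = cutoff2 c0 R (2 * k)"
  have "\<exists>w1 w2. real_polynomial_function w1 \<and> real_polynomial_function w2 \<and>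
      (\<forall>x. has_dir_deriv w b (w1 x) x) \<and> (\<forall>x. has_dir_deriv w1 b (w2 x) x)" for b
    using real_polynomial_function_dir_deriv w by metis
  then obtain w1 w2 where w12: "\<And>b. real_polynomial_function (w1 b)" "\<And>b. real_polynomial_function (w2 b)"
      "\<And>b x. has_dir_deriv w b (w1 b x) x" "\<And>b x. has_dir_deriv (w1 b) b (w2 b x) x"
    by metis
  note wcont = continuous_on_real_polynomial_function[OF w]
    continuous_on_real_polynomial_function[OF w12(1)] continuous_on_real_polynomial_function[OF w12(2)]
  \<comment> \<open>\<open>W\<close> is the Laplacian of \<open>w\<close>. For
    \<open>z = v - w\<close> the equation says that the time derivative of \<open>z\<close> is its
    Laplacian plus \<open>W - f (w + z)\<close>.\<close>
  define W where "W x = (\<Sum>b\<in>Basis. w2 b x)" for x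
  have Wcont: "continuous_on S W" for S
    unfolding W_def by (intro continuous_intros wcont)
  obtain M where M: "0 \<le> M" "\<And>x. x \<in> Q \<Longrightarrow> \<bar>w x\<bar> \<le> M"
    unfolding Q_def using continuous_on_cbox_bounded[OF wcont(1)] by blast
  obtain D where D: "0 \<le> D" "\<And>x. x \<in> Q \<Longrightarrow> \<bar>W x\<bar> \<le> D"
    unfolding Q_def using continuous_on_cbox_bounded[OF Wcont] by blast
  obtain B where B: "\<And>x w z d. \<bar>w\<bar> \<le> M \<Longrightarrow> \<bar>d\<bar> \<le> D \<Longrightarrow>
    (\<Sum>b\<in>Basis. \<phi>2 b x) * reg_power \<delta> r z + \<phi> x * (reg_power' \<delta> r z * (d - f (w + z))) \<le> B"
    unfolding \<phi>2_def \<phi>_def by (rule absorption_estimate[OF f pos M(1) D(1) \<delta> r R k, of c0]) blast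
  have \<phi>cont: "continuous_on S \<phi>" for S
    unfolding \<phi>_def by (intro continuous_intros)
  have \<phi>2cont: "continuous_on S (\<phi>2 b)" for S b
    unfolding \<phi>2_def by (intro continuous_intros)
  define E where "E v t = integral Q (\<lambda>x. \<phi> x * reg_power \<delta> r (v t x - w x))" for v :: "real \<Rightarrow> 'a \<Rightarrow> real" and t
  have "E v t \<le> E v s + B * measure lborel Q * (t - s)"
    if cs: "classical_solution \<Omega> f g v" and st: "0 < s" "s \<le> t" for g v s t
  proof -
    have QO: "Q \<subseteq> \<Omega>" using \<Omega> by (simp add: Q_def)
    define E' where "E' t = integral Q (\<lambda>x. \<phi> x * (reg_power' \<delta> r (v t x - w x) * deriv (\<lambda>s. v s x) t))" for t
    have dE: "(E v has_real_derivative E' t) (at t)" if t: "0 < t" for t :: real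
    proof -
      have "(E v has_real_derivative E' t) (at t within {0<..})"
        unfolding E_def[abs_def] E'_def Q_def
      proof (rule leibniz_rule_field_derivative)
        fix t :: real and x :: 'a assume tx: "t \<in> {0<..}" "x \<in> cbox l u"
        have "(\<lambda>s. v s x) differentiable (at t)"
          using cs tx QO unfolding classical_solution_def Q_def by auto
        then have "((\<lambda>s. v s x) has_real_derivative deriv (\<lambda>s. v s x) t) (at t)"
          by (simp add: DERIV_deriv_iff_real_differentiable)
        then have "((\<lambda>s. reg_power \<delta> r (v s x - w x)) has_real_derivative
            reg_power' \<delta> r (v t x - w x) * deriv (\<lambda>s. v s x) t) (at t)"
          by (intro DERIV_chain2[OF DERIV_reg_power[OF \<delta>]]) (auto intro!: derivative_eq_intros)
        then show "((\<lambda>s. \<phi> x * reg_power \<delta> r (v s x - w x)) has_real_derivative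
            \<phi> x * (reg_power' \<delta> r (v t x - w x) * deriv (\<lambda>s. v s x) t)) (at t within {0<..})"
          by (intro has_field_derivative_at_within[OF DERIV_cmult])
      next
        fix t :: real assume "t \<in> {0<..}"
        \<comment> \<open>\<open>SOME_Basis\<close> only supplies the basis vector that the
          continuity fact formally asks for.\<close>
        then have "continuous_on Q (v t)"
          by (intro continuous_on_subset[OF classical_solution_partials(3)[OF cs _ SOME_Basis] QO]) simp
        then show "(\<lambda>x. \<phi> x * reg_power \<delta> r (v t x - w x)) integrable_on cbox l u"
          unfolding Q_def by (intro integrable_continuous continuous_intros continuous_on_reg_power \<delta> \<phi>cont wcont)
      next
        have \<phi>': "continuous_on ({0<..} \<times> Q) (\<lambda>y. \<phi> (snd y))" "continuous_on ({0<..} \<times> Q) (\<lambda>y. w (snd y))"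
          by (rule continuous_on_compose2[OF \<phi>cont[of UNIV]] continuous_on_compose2[OF wcont(1)[of UNIV]];
              auto intro: continuous_intros)+
        show "continuous_on ({0<..} \<times> cbox l u)
            (\<lambda>(t, x). \<phi> x * (reg_power' \<delta> r (v t x - w x) * deriv (\<lambda>s. v s x) t))"
          unfolding Q_def[symmetric] split_beta
          by (intro continuous_intros continuous_on_reg_power \<delta> \<phi>' classical_solution_continuous_on[OF cs QO])
      qed (use t in auto)
      then show ?thesis using t by (simp add: at_within_open[of t "{0<..}"])
    qed
    have E': "E' t \<le> B * measure lborel Q" if t: "0 < t" for t
    proof -
      define z where "z x = v t x - w x" for x
      define z1 where "z1 b x = partial b (v t) x - w1 b x" for b x
      define z2 where "z2 b x = partial b (partial b (v t)) x - w2 b x" for b x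
      note cl = classical_solution_partials[OF cs t]
      have zd: "has_dir_deriv z b (z1 b x) x" "has_dir_deriv (z1 b) b (z2 b x) x"
        if "b \<in> Basis" "x \<in> \<Omega>" for b x
        unfolding z_def[abs_def] z1_def[abs_def] z2_def by (intro has_dir_deriv_diff cl that w12)+
      have zc: "continuous_on \<Omega> z" "continuous_on \<Omega> (z1 b)" "continuous_on \<Omega> (z2 b)" if "b \<in> Basis" for b
        unfolding z_def[abs_def] z1_def[abs_def] z2_def[abs_def] by (intro continuous_intros cl(3-5)[OF that] wcont)+
      have zQ: "continuous_on Q z" "\<And>b. b \<in> Basis \<Longrightarrow> continuous_on Q (z2 b)"
        by (intro continuous_on_subset[OF _ QO] zc(1)[OF SOME_Basis] zc(3) | assumption)+
      note cont = continuous_intros continuous_on_reg_power \<delta> \<phi>cont \<phi>2cont wcont Wcont zQ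
        continuous_on_compose2[OF power_growth_continuous[OF f, of UNIV]]
      define H where "H x = \<phi> x * (reg_power' \<delta> r (z x) * (W x - f (w x + z x)))" for x
      have Hcont: "continuous_on Q H"
        unfolding H_def by (intro cont) auto
      note ints = integrable_continuous[of l u, folded Q_def]
      \<comment> \<open>The equation replaces the time derivative. Second derivatives of
        \<open>z\<close> are kept apart by direction, for the inequality in each single direction;
        all the rest goes into \<open>H\<close>.\<close>
      have eq: "\<phi> x * (reg_power' \<delta> r (v t x - w x) * deriv (\<lambda>s. v s x) t) =
          (\<Sum>b\<in>Basis. \<phi> x * (reg_power' \<delta> r (z x) * z2 b x)) + H x" if "x \<in> Q" for x
      proof -
        have "deriv (\<lambda>s. v s x) t = laplacian (v t) x - f (v t x)"
          using cs t that QO unfolding classical_solution_def by (auto simp: algebra_simps)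
        also have "\<dots> = (\<Sum>b\<in>Basis. z2 b x) + (W x - f (w x + z x))"
          by (simp add: laplacian_def z2_def W_def z_def sum_subtractf)
        finally show ?thesis
          by (simp add: H_def z_def[symmetric] sum_distrib_left distrib_left)
      qed
      have "E' t = integral Q (\<lambda>x. (\<Sum>b\<in>Basis. \<phi> x * (reg_power' \<delta> r (z x) * z2 b x)) + H x)"
        unfolding E'_def by (rule integral_cong) (rule eq)
      also have "\<dots> = (\<Sum>b\<in>Basis. integral Q (\<lambda>x. \<phi> x * (reg_power' \<delta> r (z x) * z2 b x))) + integral Q H"
        by (subst integral_add; (subst integral_sum)?) (intro ints cont Hcont refl finite_Basis | assumption)+
      also have "\<dots> \<le> (\<Sum>b\<in>Basis. integral Q (\<lambda>x. \<phi>2 b x * reg_power \<delta> r (z x))) + integral Q H"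
      proof (intro add_mono sum_mono order_refl)
        fix b :: 'a assume b: "b \<in> Basis"
        show "integral Q (\<lambda>x. \<phi> x * (reg_power' \<delta> r (z x) * z2 b x)) \<le> integral Q (\<lambda>x. \<phi>2 b x * reg_power \<delta> r (z x))"
          unfolding Q_def
        proof (rule integral_Kato_inequality[OF \<delta> r \<Omega> compact_cball ball, where ?z1.0="z1 b"])
          show "has_dir_deriv \<phi> b (cutoff1 c0 R (2 * k) b x) x" for x
            unfolding \<phi>_def cutoff1_def by (rule has_dir_deriv_cutoff)
          show "has_dir_deriv (cutoff1 c0 R (2 * k) b) b (\<phi>2 b x) x" for x
            unfolding \<phi>2_def using k by (intro has_dir_deriv_cutoff1) simp
          show "\<phi> x = 0 \<and> cutoff1 c0 R (2 * k) b x = 0 \<and> \<phi>2 b x = 0" if "x \<notin> cball c0 R" for x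
            using that R k by (simp add: \<phi>_def cutoff1_def \<phi>2_def cutoff2_def cutoff_eq_0)
          show "0 \<le> \<phi> x" for x by (simp add: \<phi>_def cutoff_nonneg)
        qed (intro \<phi>cont \<phi>2cont continuous_on_cutoff1 zd[OF b] zc[OF b] | assumption)+
      qed
      also have "\<dots> = integral Q (\<lambda>x. (\<Sum>b\<in>Basis. \<phi>2 b x * reg_power \<delta> r (z x)) + H x)"
        by (subst integral_add; (subst integral_sum)?) (intro ints cont Hcont refl finite_Basis | assumption)+
      \<comment> \<open>Cutoff terms and reaction term are recombined under one integral because
        only their sum is bounded above independently of \<open>z\<close>.\<close>
      also have "\<dots> \<le> integral Q (\<lambda>_. B)"
      proof (rule integral_le)
        show "(\<lambda>x. (\<Sum>b\<in>Basis. \<phi>2 b x * reg_power \<delta> r (z x)) + H x) integrable_on Q"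
          by (intro ints cont Hcont)
        show "(\<lambda>_. B) integrable_on Q" by (intro ints cont)
        show "(\<Sum>b\<in>Basis. \<phi>2 b x * reg_power \<delta> r (z x)) + H x \<le> B" if "x \<in> Q" for x
          using B[OF M(2)[OF that] D(2)[OF that], of x "z x"] by (simp add: H_def sum_distrib_right)
      qed
      also have "\<dots> = B * measure lborel Q" by (simp add: Q_def)
      finally show ?thesis .
    qed
    have "B * measure lborel Q * s - E v s \<le> B * measure lborel Q * t - E v t"
    proof (rule DERIV_nonneg_imp_nondecreasing[OF st(2)])
      fix x assume "s \<le> x"
      then have "0 < x" using st by simp
      then have "((\<lambda>t. B * measure lborel Q * t - E v t) has_real_derivative B * measure lborel Q - E' x) (at x)"
        by (auto intro!: derivative_eq_intros dE)
      then show "\<exists>y. ((\<lambda>t. B * measure lborel Q * t - E v t) has_real_derivative y) (at x) \<and> 0 \<le> y"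
        using E'[OF \<open>0 < x\<close>] by (intro exI[of _ "B * measure lborel Q - E' x"]) auto
    qed
    then show ?thesis by (simp add: algebra_simps)
  qed
  then show thesis
    unfolding E_def Q_def \<phi>_def by (rule that)
qed

section \<open>Polynomials are dense in Lp\<close>

text \<open>The \<open>r\<close>-th power of the norm. Integrals of powers can be estimated and
  summed without Minkowski's inequality, at the price of constants such as
  \<open>3 powr r\<close>.\<close>

definition Lp_int :: "real \<Rightarrow> 'a::euclidean_space set \<Rightarrow> ('a \<Rightarrow> real) \<Rightarrow> real" where
  "Lp_int r A h = (LINT x|lebesgue_on A. \<bar>h x\<bar> powr r)"

lemma Lp_norm_eq: "Lp_norm r A h = Lp_int r A h powr (1 / r)"
  by (simp add: Lp_norm_def Lp_int_def)

lemma Lp_int_nonneg: "0 \<le> Lp_int r A h"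
  by (simp add: Lp_int_def)

lemma Lp_int_commute: "Lp_int r A (\<lambda>x. f x - g x) = Lp_int r A (\<lambda>x. g x - f x)"
  by (simp add: Lp_int_def abs_minus_commute)

lemma Lp_int_less_iff:
  assumes "0 < r" "0 < e"
  shows "Lp_norm r A h < e \<longleftrightarrow> Lp_int r A h < e powr r"
proof -
  have "Lp_int r A h = Lp_norm r A h powr r"
    using assms Lp_int_nonneg[of r A h] by (simp add: Lp_norm_eq powr_powr)
  moreover have "0 \<le> Lp_norm r A h" by (simp add: Lp_norm_eq)
  then have "Lp_norm r A h < e \<longleftrightarrow> Lp_norm r A h powr r < e powr r"
    using assms powr_less_mono2[of r "Lp_norm r A h" e] powr_mono2[of r e "Lp_norm r A h"] by fastforce
  ultimately show ?thesis by simp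
qed

text \<open>The sum is at most three times the largest absolute value \<open>m\<close>, and
  \<open>m powr r\<close> is one of the summands on the right. Three terms are provided because the
  triangle estimate below inserts two intermediate functions.\<close>

lemma powr_sum3_le:
  fixes a b c r :: real
  assumes "0 \<le> r"
  shows "\<bar>a + b + c\<bar> powr r \<le> 3 powr r * (\<bar>a\<bar> powr r + \<bar>b\<bar> powr r + \<bar>c\<bar> powr r)"
proof -
  define m where "m = max \<bar>a\<bar> (max \<bar>b\<bar> \<bar>c\<bar>)"
  have "\<bar>a + b + c\<bar> powr r \<le> (3 * m) powr r"
    using assms by (intro powr_mono2) (auto simp: m_def)
  also have "\<dots> = 3 powr r * m powr r" by (simp add: powr_mult)
  also have "m powr r \<le> \<bar>a\<bar> powr r + \<bar>b\<bar> powr r + \<bar>c\<bar> powr r"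
    unfolding m_def max_def by simp
  finally show ?thesis by simp
qed

lemma Lp_space_diff:
  assumes "f \<in> Lp_space r A" "g \<in> Lp_space r A" "0 \<le> r"
  shows "(\<lambda>x. f x - g x) \<in> Lp_space r A"
proof -
  have m [measurable]: "f \<in> borel_measurable (lebesgue_on A)" "g \<in> borel_measurable (lebesgue_on A)"
    and i: "integrable (lebesgue_on A) (\<lambda>x. \<bar>f x\<bar> powr r)" "integrable (lebesgue_on A) (\<lambda>x. \<bar>g x\<bar> powr r)"
    using assms by (auto simp: Lp_space_def)
  have "integrable (lebesgue_on A) (\<lambda>x. \<bar>f x - g x\<bar> powr r)"
  proof (rule Bochner_Integration.integrable_bound)
    show "integrable (lebesgue_on A) (\<lambda>x. 3 powr r * (\<bar>f x\<bar> powr r + \<bar>g x\<bar> powr r + \<bar>0\<bar> powr r))"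
      using i by simp
    show "AE x in lebesgue_on A. norm (\<bar>f x - g x\<bar> powr r) \<le> norm (3 powr r * (\<bar>f x\<bar> powr r + \<bar>g x\<bar> powr r + \<bar>0\<bar> powr r))"
      using powr_sum3_le[OF assms(3), of "f _" "- g _" 0] by simp
  qed simp
  with m show ?thesis by (simp add: Lp_space_def)
qed

lemma Lp_int_triangle:
  assumes "a \<in> Lp_space r A" "b \<in> Lp_space r A" "c \<in> Lp_space r A" "d \<in> Lp_space r A" "0 \<le> r"
  shows "Lp_int r A (\<lambda>x. a x - d x) \<le>
    3 powr r * (Lp_int r A (\<lambda>x. a x - b x) + Lp_int r A (\<lambda>x. b x - c x) + Lp_int r A (\<lambda>x. c x - d x))"
proof -
  have i: "integrable (lebesgue_on A) (\<lambda>x. \<bar>f x - g x\<bar> powr r)" if "f \<in> Lp_space r A" "g \<in> Lp_space r A" for f g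
    using Lp_space_diff[OF that assms(5)] by (simp add: Lp_space_def)
  note ints = i[OF assms(1,2)] i[OF assms(2,3)] i[OF assms(3,4)]
  have "Lp_int r A (\<lambda>x. a x - d x) \<le> (LINT x|lebesgue_on A.
      3 powr r * (\<bar>a x - b x\<bar> powr r + \<bar>b x - c x\<bar> powr r + \<bar>c x - d x\<bar> powr r))"
    unfolding Lp_int_def
  proof (rule integral_mono)
    show "\<bar>a x - d x\<bar> powr r \<le> 3 powr r * (\<bar>a x - b x\<bar> powr r + \<bar>b x - c x\<bar> powr r + \<bar>c x - d x\<bar> powr r)" for x
      using powr_sum3_le[OF assms(5), of "a x - b x" "b x - c x" "c x - d x"] by simp
    show "integrable (lebesgue_on A) (\<lambda>x. 3 powr r * (\<bar>a x - b x\<bar> powr r + \<bar>b x - c x\<bar> powr r + \<bar>c x - d x\<bar> powr r))"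
      by (intro Bochner_Integration.integrable_mult_right Bochner_Integration.integrable_add ints)
  qed (intro i assms)
  also have "\<dots> = 3 powr r * (Lp_int r A (\<lambda>x. a x - b x) + Lp_int r A (\<lambda>x. b x - c x) + Lp_int r A (\<lambda>x. c x - d x))"
    using ints by (simp add: Lp_int_def)
  finally show ?thesis .
qed

lemma Lp_space_subset:
  assumes "h \<in> Lp_space r B" "A \<subseteq> B" "A \<in> sets lebesgue" "B \<in> sets lebesgue"
  shows "h \<in> Lp_space r A"
proof -
  have "set_integrable lebesgue B (\<lambda>x. \<bar>h x\<bar> powr r)"
    using assms by (simp add: Lp_space_def integrable_restrict_space set_integrable_def)
  then have "set_integrable lebesgue A (\<lambda>x. \<bar>h x\<bar> powr r)"
    using assms by (meson set_integrable_subset)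
  moreover have "h \<in> borel_measurable (lebesgue_on A)"
    using assms(1) by (intro measurable_restrict_mono[OF _ assms(2)]) (simp add: Lp_space_def)
  ultimately show ?thesis
    using assms by (simp add: Lp_space_def integrable_restrict_space set_integrable_def)
qed

lemma Lp_int_mono:
  assumes "h \<in> Lp_space r B" "A \<subseteq> B" "A \<in> sets lebesgue" "B \<in> sets lebesgue"
  shows "Lp_int r A h \<le> Lp_int r B h"
proof -
  have i: "integrable lebesgue (\<lambda>x. indicator B x *\<^sub>R \<bar>h x\<bar> powr r)" "integrable lebesgue (\<lambda>x. indicator A x *\<^sub>R \<bar>h x\<bar> powr r)"
    using assms Lp_space_subset[OF assms] by (simp_all add: Lp_space_def integrable_restrict_space)
  have "(LINT x|lebesgue. indicator A x *\<^sub>R \<bar>h x\<bar> powr r) \<le> (LINT x|lebesgue. indicator B x *\<^sub>R \<bar>h x\<bar> powr r)"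
    using i assms(2) by (intro integral_mono) (auto simp: indicator_def)
  then show ?thesis
    using assms by (simp add: Lp_int_def integral_restrict_space)
qed

text \<open>The indicator of \<open>C\<close> is at most the sum of the indicators of the covering
  sets.\<close>

lemma Lp_int_finite_cover:
  assumes "finite I" "C \<subseteq> (\<Union>i\<in>I. B i)" "\<And>i. i \<in> I \<Longrightarrow> h \<in> Lp_space r (B i)"
    "\<And>i. i \<in> I \<Longrightarrow> B i \<in> sets lebesgue" "C \<in> sets lebesgue" "h \<in> Lp_space r C"
  shows "Lp_int r C h \<le> (\<Sum>i\<in>I. Lp_int r (B i) h)"
proof -
  have i: "integrable lebesgue (\<lambda>x. indicator C x *\<^sub>R \<bar>h x\<bar> powr r)"
    "\<And>i. i \<in> I \<Longrightarrow> integrable lebesgue (\<lambda>x. indicator (B i) x *\<^sub>R \<bar>h x\<bar> powr r)"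
    using assms by (simp_all add: Lp_space_def integrable_restrict_space)
  have "(LINT x|lebesgue. indicator C x *\<^sub>R \<bar>h x\<bar> powr r) \<le> (LINT x|lebesgue. (\<Sum>i\<in>I. indicator (B i) x *\<^sub>R \<bar>h x\<bar> powr r))"
  proof (rule integral_mono)
    fix x
    show "indicator C x *\<^sub>R \<bar>h x\<bar> powr r \<le> (\<Sum>i\<in>I. indicator (B i) x *\<^sub>R \<bar>h x\<bar> powr r)"
    proof (cases "x \<in> C")
      case True
      then obtain i where "i \<in> I" "x \<in> B i" using assms(2) by blast
      then show ?thesis
        using assms(1) True by (intro order_trans[OF _ member_le_sum[of i]]) auto
    qed (auto intro: sum_nonneg)
  qed (use i in auto)
  also have "\<dots> = (\<Sum>i\<in>I. (LINT x|lebesgue. indicator (B i) x *\<^sub>R \<bar>h x\<bar> powr r))"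
    using i by (intro Bochner_Integration.integral_sum)
  finally show ?thesis
    using assms by (simp add: Lp_int_def integral_restrict_space)
qed

lemma Lp_space_continuous:
  fixes h :: "'a::euclidean_space \<Rightarrow> real"
  assumes "continuous_on (cbox l u) h" "0 < r"
  shows "h \<in> Lp_space r (cbox l u)"
proof -
  have "continuous_on (cbox l u) (\<lambda>x. \<bar>h x\<bar> powr r)"
    using assms by (intro continuous_intros continuous_on_powr') auto
  then show ?thesis
    using assms(1) by (simp add: Lp_space_def continuous_imp_integrable continuous_imp_measurable_on_sets_lebesgue)
qed

lemma Lp_int_bounded:
  fixes h :: "'a::euclidean_space \<Rightarrow> real"
  assumes "h \<in> Lp_space r (cbox l u)" "\<And>x. x \<in> cbox l u \<Longrightarrow> \<bar>h x\<bar> \<le> M" "0 \<le> r"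
  shows "Lp_int r (cbox l u) h \<le> M powr r * measure lebesgue (cbox l u)"
proof -
  have "Lp_int r (cbox l u) h \<le> (LINT x|lebesgue_on (cbox l u). M powr r)"
    unfolding Lp_int_def using assms
    by (intro integral_mono) (auto simp: Lp_space_def intro!: powr_mono2 continuous_imp_integrable)
  then show ?thesis by (simp add: measure_restrict_space mult.commute)
qed

section \<open>Approximation by truncation, continuous functions and polynomials\<close>

definition clamp_abs :: "real \<Rightarrow> real \<Rightarrow> real" where
  "clamp_abs M y = max (- M) (min M y)"

lemma abs_clamp_abs_le: "0 \<le> M \<Longrightarrow> \<bar>clamp_abs M y\<bar> \<le> M" "0 \<le> M \<Longrightarrow> \<bar>clamp_abs M y\<bar> \<le> \<bar>y\<bar>"
  "0 \<le> M \<Longrightarrow> \<bar>y - clamp_abs M y\<bar> \<le> \<bar>y\<bar>" "\<bar>y\<bar> \<le> M \<Longrightarrow> clamp_abs M y = y"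
  by (auto simp: clamp_abs_def)

lemma clamp_abs_measurable [measurable]: "clamp_abs M \<in> borel_measurable borel"
  unfolding clamp_abs_def by measurable

lemma continuous_on_clamp_abs [continuous_intros]:
  "continuous_on S h \<Longrightarrow> continuous_on S (\<lambda>x. clamp_abs M (h x))"
  unfolding clamp_abs_def by (intro continuous_intros)

lemma Lp_space_clamp_abs:
  assumes "h \<in> Lp_space r A" "0 \<le> r" "0 \<le> M"
  shows "(\<lambda>x. clamp_abs M (h x)) \<in> Lp_space r A"
proof -
  have [measurable]: "h \<in> borel_measurable (lebesgue_on A)" and i: "integrable (lebesgue_on A) (\<lambda>x. \<bar>h x\<bar> powr r)"
    using assms by (auto simp: Lp_space_def)
  have "integrable (lebesgue_on A) (\<lambda>x. \<bar>clamp_abs M (h x)\<bar> powr r)"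
    using assms by (intro Bochner_Integration.integrable_bound[OF i]) (auto intro!: powr_mono2 abs_clamp_abs_le)
  then show ?thesis by (simp add: Lp_space_def)
qed

lemma tendsto_abs_powr_0:
  fixes h :: "'b \<Rightarrow> real"
  assumes "(h \<longlongrightarrow> l) F" "0 < r"
  shows "((\<lambda>n. \<bar>h n - l\<bar> powr r) \<longlongrightarrow> 0) F"
proof -
  have "((\<lambda>n. \<bar>h n - l\<bar>) \<longlongrightarrow> 0) F"
    using assms(1) by (simp add: LIM_zero tendsto_rabs_zero)
  then show ?thesis
    using assms(2) by (intro tendsto_zero_powrI[OF _ tendsto_const]) auto
qed

text \<open>Each point is unaffected by the truncation from some \<open>n\<close> on, and
  \<open>\<bar>h x\<bar> powr r\<close> dominates.\<close>

lemma Lp_truncation: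
  assumes "h \<in> Lp_space r A" "0 < r"
  shows "(\<lambda>n. Lp_int r A (\<lambda>x. h x - clamp_abs (real n) (h x))) \<longlonglongrightarrow> 0"
proof -
  have [measurable]: "h \<in> borel_measurable (lebesgue_on A)" and i: "integrable (lebesgue_on A) (\<lambda>x. \<bar>h x\<bar> powr r)"
    using assms by (auto simp: Lp_space_def)
  have "(\<lambda>n. LINT x|lebesgue_on A. \<bar>h x - clamp_abs (real n) (h x)\<bar> powr r) \<longlonglongrightarrow> (LINT x|lebesgue_on A. 0)"
  proof (rule integral_dominated_convergence[OF _ _ i])
    have "(\<lambda>n. \<bar>h x - clamp_abs (real n) (h x)\<bar> powr r) \<longlonglongrightarrow> 0" for x
    proof (rule tendsto_eventually)
      obtain N :: nat where "\<bar>h x\<bar> \<le> real N" using real_arch_simple by blast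
      then show "\<forall>\<^sub>F n in sequentially. \<bar>h x - clamp_abs (real n) (h x)\<bar> powr r = 0"
        by (intro eventually_sequentiallyI[of N]) (simp add: abs_clamp_abs_le)
    qed
    then show "AE x in lebesgue_on A. (\<lambda>n. \<bar>h x - clamp_abs (real n) (h x)\<bar> powr r) \<longlonglongrightarrow> 0" by simp
    show "AE x in lebesgue_on A. norm (\<bar>h x - clamp_abs (real n) (h x)\<bar> powr r) \<le> \<bar>h x\<bar> powr r" for n
      using assms by (auto intro!: powr_mono2 abs_clamp_abs_le)
  qed auto
  then show ?thesis by (simp add: Lp_int_def)
qed

text \<open>Lebesgue measurability yields continuous functions converging almost everywhere, but
  without a common bound. Clamping them together with \<open>h\<close> keeps them continuous and
  supplies the dominating constant \<open>(2 * M) powr r\<close>, integrable on the box.\<close>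

lemma Lp_continuous_approx:
  fixes h :: "'a::euclidean_space \<Rightarrow> real"
  assumes h: "h \<in> Lp_space r (cbox l u)" "0 < r" and M: "0 \<le> M" and e: "0 < e"
  obtains g where "continuous_on UNIV g"
    "Lp_int r (cbox l u) (\<lambda>x. clamp_abs M (h x) - g x) < e"
proof -
  have m [measurable]: "h \<in> borel_measurable (lebesgue_on (cbox l u))"
    using h by (simp add: Lp_space_def)
  then have "h measurable_on cbox l u"
    by (simp add: measurable_on_iff_borel_measurable)
  then obtain N g where N: "negligible N" and g: "\<And>n. continuous_on UNIV (g n)"
    and lim: "\<And>x. x \<notin> N \<Longrightarrow> (\<lambda>n. g n x) \<longlonglongrightarrow> (if x \<in> cbox l u then h x else 0)"
    unfolding measurable_on_def by blast
  have gm [measurable]: "g n \<in> borel_measurable (lebesgue_on (cbox l u))" for n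
    using continuous_on_subset[OF g] by (intro continuous_imp_measurable_on_sets_lebesgue) auto
  have "(\<lambda>n. LINT x|lebesgue_on (cbox l u). \<bar>clamp_abs M (h x) - clamp_abs M (g n x)\<bar> powr r)
      \<longlonglongrightarrow> (LINT x|lebesgue_on (cbox l u). 0)"
  proof (rule integral_dominated_convergence[where w="\<lambda>_. (2 * M) powr r"])
    have "N \<in> null_sets lebesgue" using N by (simp add: negligible_iff_null_sets)
    then have "AE x in lebesgue. x \<notin> N" by (rule AE_not_in)
    then have "AE x in lebesgue_on (cbox l u). x \<notin> N" by (auto simp: AE_restrict_space_iff)
    moreover have "AE x in lebesgue_on (cbox l u). x \<in> cbox l u"
      by (rule AE_I2) simp
    ultimately show "AE x in lebesgue_on (cbox l u). (\<lambda>n. \<bar>clamp_abs M (h x) - clamp_abs M (g n x)\<bar> powr r) \<longlonglongrightarrow> 0"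
    proof eventually_elim
      case (elim x)
      then have "(\<lambda>n. clamp_abs M (g n x)) \<longlonglongrightarrow> clamp_abs M (h x)"
        using lim[of x] unfolding clamp_abs_def by (intro tendsto_intros) simp
      from tendsto_abs_powr_0[OF this h(2)] show ?case by (simp add: abs_minus_commute)
    qed
    show "AE x in lebesgue_on (cbox l u). norm (\<bar>clamp_abs M (h x) - clamp_abs M (g n x)\<bar> powr r) \<le> (2 * M) powr r" for n
    proof (rule AE_I2)
      fix x
      have "\<bar>clamp_abs M (h x) - clamp_abs M (g n x)\<bar> \<le> 2 * M"
        using abs_clamp_abs_le(1)[OF M, of "h x"] abs_clamp_abs_le(1)[OF M, of "g n x"] by linarith
      then show "norm (\<bar>clamp_abs M (h x) - clamp_abs M (g n x)\<bar> powr r) \<le> (2 * M) powr r"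
        using h(2) by (simp add: powr_mono2)
    qed
    show "integrable (lebesgue_on (cbox l u)) (\<lambda>_. (2 * M) powr r)"
      by (intro continuous_imp_integrable continuous_intros)
  qed auto
  then have "(\<lambda>n. Lp_int r (cbox l u) (\<lambda>x. clamp_abs M (h x) - clamp_abs M (g n x))) \<longlonglongrightarrow> 0"
    by (simp add: Lp_int_def)
  then have "\<forall>\<^sub>F n in sequentially. Lp_int r (cbox l u) (\<lambda>x. clamp_abs M (h x) - clamp_abs M (g n x)) < e"
    using e order_tendstoD(2) by blast
  then obtain n where "Lp_int r (cbox l u) (\<lambda>x. clamp_abs M (h x) - clamp_abs M (g n x)) < e"
    using eventually_sequentially by auto
  then show thesis
    using that[of "\<lambda>x. clamp_abs M (g n x)"] g by (simp add: continuous_on_clamp_abs)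
qed

lemma Lp_polynomial_approx:
  fixes h :: "'a::euclidean_space \<Rightarrow> real"
  assumes h: "h \<in> Lp_space r (cbox l u)" and r: "0 < r" and e: "0 < e"
  obtains w where "real_polynomial_function w" "Lp_int r (cbox l u) (\<lambda>x. h x - w x) < e"
proof -
  \<comment> \<open>Three errors are added and multiplied by \<open>3 powr r\<close>.\<close>
  define e' where "e' = e / (3 powr r * 3)"
  have e': "0 < e'" using e by (simp add: e'_def)
  define \<mu> where "\<mu> = measure lebesgue (cbox l u)"
  \<comment> \<open>A uniform distance \<open>d\<close> on the box costs
    \<open>d powr r * \<mu>\<close>, which is below \<open>e'\<close>; the summand 1 covers a box of
    measure 0.\<close>
  define d where "d = (e' / (\<mu> + 1)) powr (1 / r)"
  have \<mu>: "0 \<le> \<mu>" by (simp add: \<mu>_def)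
  have d: "0 < d" using e' \<mu> by (simp add: d_def)
  obtain n where n: "Lp_int r (cbox l u) (\<lambda>x. h x - clamp_abs (real n) (h x)) < e'"
    using order_tendstoD(2)[OF Lp_truncation[OF h r] e'] eventually_sequentially by auto
  obtain g where g: "continuous_on UNIV g" "Lp_int r (cbox l u) (\<lambda>x. clamp_abs (real n) (h x) - g x) < e'"
    using Lp_continuous_approx[OF h r _ e', of "real n"] by auto
  obtain w where w: "real_polynomial_function w" "\<And>x. x \<in> cbox l u \<Longrightarrow> \<bar>g x - w x\<bar> < d"
    using Stone_Weierstrass_real_polynomial_function[OF compact_cbox continuous_on_subset[OF g(1)] d] by auto
  have gL: "g \<in> Lp_space r (cbox l u)" "w \<in> Lp_space r (cbox l u)"
    by (intro Lp_space_continuous[OF _ r] continuous_on_real_polynomial_function[OF w(1)]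
      continuous_on_subset[OF g(1)] subset_UNIV)+
  have "Lp_int r (cbox l u) (\<lambda>x. g x - w x) \<le> d powr r * \<mu>"
    unfolding \<mu>_def using w(2) gL r by (intro Lp_int_bounded Lp_space_diff) (auto intro: less_imp_le)
  also have "\<dots> = e' / (\<mu> + 1) * \<mu>" using r \<mu> e' by (simp add: d_def powr_powr)
  also have "\<dots> < e'" using e' \<mu> by (simp add: field_simps)
  finally have "Lp_int r (cbox l u) (\<lambda>x. h x - clamp_abs (real n) (h x)) +
      Lp_int r (cbox l u) (\<lambda>x. clamp_abs (real n) (h x) - g x) + Lp_int r (cbox l u) (\<lambda>x. g x - w x) < 3 * e'"
    using n g(2) by linarith
  then have "3 powr r * (Lp_int r (cbox l u) (\<lambda>x. h x - clamp_abs (real n) (h x)) +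
      Lp_int r (cbox l u) (\<lambda>x. clamp_abs (real n) (h x) - g x) + Lp_int r (cbox l u) (\<lambda>x. g x - w x)) < 3 powr r * (3 * e')"
    by simp
  moreover have "Lp_int r (cbox l u) (\<lambda>x. h x - w x) \<le> 3 powr r * (Lp_int r (cbox l u) (\<lambda>x. h x - clamp_abs (real n) (h x)) +
      Lp_int r (cbox l u) (\<lambda>x. clamp_abs (real n) (h x) - g x) + Lp_int r (cbox l u) (\<lambda>x. g x - w x))"
    using r by (intro Lp_int_triangle h Lp_space_clamp_abs gL) auto
  ultimately have "Lp_int r (cbox l u) (\<lambda>x. h x - w x) < 3 powr r * (3 * e')"
    by linarith
  then show thesis using that[OF w(1)] by (simp add: e'_def)
qed

section \<open>Convergence to the initial datum\<close>

text \<open>Lebesgue measure is complete, so measurability passes to functions that are equal almost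
  everywhere. Multiplication by the indicator of \<open>A\<close> moves the question to the whole
  space, where this is applied.\<close>

lemma Lp_AE_cong:
  assumes h: "h \<in> Lp_space r A" and ae: "AE x in lebesgue_on A. h x = g x" and A: "A \<in> sets lebesgue"
  shows "g \<in> Lp_space r A" "Lp_int r A g = Lp_int r A h"
proof -
  have A': "A \<inter> space lebesgue \<in> sets lebesgue" using A by simp
  have hm: "h \<in> borel_measurable (lebesgue_on A)" using h by (simp add: Lp_space_def)
  have "(\<lambda>x. indicator A x *\<^sub>R h x) \<in> borel_measurable lebesgue"
    using hm by (simp only: borel_measurable_restrict_space_iff[OF A'])
  moreover have "AE x in lebesgue. indicator A x *\<^sub>R h x = indicator A x *\<^sub>R g x"
    using ae unfolding AE_restrict_space_iff[OF A'] by eventually_elim (simp add: indicator_def)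
  ultimately have "(\<lambda>x. indicator A x *\<^sub>R g x) \<in> borel_measurable lebesgue"
    by (rule borel_measurable_AE)
  then have gm: "g \<in> borel_measurable (lebesgue_on A)"
    by (simp only: borel_measurable_restrict_space_iff[OF A'])
  have ae': "AE x in lebesgue_on A. \<bar>g x\<bar> powr r = \<bar>h x\<bar> powr r"
    using ae by eventually_elim simp
  have m: "(\<lambda>x. \<bar>g x\<bar> powr r) \<in> borel_measurable (lebesgue_on A)" "(\<lambda>x. \<bar>h x\<bar> powr r) \<in> borel_measurable (lebesgue_on A)"
    using gm hm by measurable
  show "g \<in> Lp_space r A"
    using h gm integrable_cong_AE[OF m ae'] by (simp add: Lp_space_def)
  show "Lp_int r A g = Lp_int r A h"
    unfolding Lp_int_def by (rule integral_cong_AE[OF m ae'])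
qed

lemma bessel_space_0:
  assumes "u \<in> bessel_space 0 r A" "A \<in> sets lebesgue"
  shows "u \<in> Lp_space r A"
proof -
  obtain h where h: "h \<in> Lp_space r UNIV" "AE x in lebesgue_on A. u x = h x"
    using assms(1) by (auto simp: bessel_space_def bessel_potential_def)
  have "AE x in lebesgue_on A. h x = u x" using h(2) by eventually_elim simp
  then show ?thesis
    using Lp_AE_cong(1)[OF Lp_space_subset[OF h(1) _ assms(2)]] assms(2) by simp
qed

text \<open>For order 0 the Bessel norm is an infimum over extensions to the whole space, and
  restricting an extension to \<open>A\<close> does not increase the integral.\<close>

lemma Lp_int_less_bessel_norm_0:
  assumes uv: "u \<in> bessel_space 0 r A" "v \<in> bessel_space 0 r A" and A: "A \<in> sets lebesgue"
    and r: "0 < r" and e: "0 < e" "bessel_norm 0 r A (\<lambda>x. u x - v x) < e"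
  shows "Lp_int r A (\<lambda>x. u x - v x) < e powr r"
proof -
  define X where "X = {Lp_norm r UNIV h | h. h \<in> Lp_space r UNIV \<and> (AE x in lebesgue_on A. u x - v x = bessel_potential 0 h x)}"
  obtain h1 h2 where h: "h1 \<in> Lp_space r UNIV" "AE x in lebesgue_on A. u x = h1 x"
    "h2 \<in> Lp_space r UNIV" "AE x in lebesgue_on A. v x = h2 x"
    using uv by (auto simp: bessel_space_def bessel_potential_def)
  have "AE x in lebesgue_on A. u x - v x = h1 x - h2 x" using h(2,4) by eventually_elim simp
  \<comment> \<open>An infimum below \<open>e\<close> yields an element below \<open>e\<close> only
    for a nonempty set; the difference of the two extensions provides a member.\<close>
  then have "Lp_norm r UNIV (\<lambda>x. h1 x - h2 x) \<in> X"
    unfolding X_def bessel_potential_def using Lp_space_diff[OF h(1,3)] r by auto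
  moreover have "Inf X < e" using e(2) by (simp add: bessel_norm_def X_def)
  ultimately obtain y where "y \<in> X" "y < e" using cInf_lessD by blast
  then obtain h where h: "h \<in> Lp_space r UNIV" "AE x in lebesgue_on A. u x - v x = h x" "Lp_norm r UNIV h < e"
    unfolding X_def bessel_potential_def by auto
  have hA: "h \<in> Lp_space r A" using Lp_space_subset[OF h(1) _ A] by simp
  have "AE x in lebesgue_on A. h x = u x - v x" using h(2) by eventually_elim simp
  then have "Lp_int r A (\<lambda>x. u x - v x) = Lp_int r A h"
    by (rule Lp_AE_cong(2)[OF hA _ A])
  also have "\<dots> \<le> Lp_int r UNIV h" using Lp_int_mono[OF h(1) _ A] by simp
  also have "\<dots> < e powr r" by (rule iffD1[OF Lp_int_less_iff[OF r e(1)] h(3)])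
  finally show ?thesis .
qed

section \<open>Comparison of the energy with local integrals\<close>

lemma reg_power_add_le:
  assumes "0 < \<delta>" "0 \<le> r"
  shows "reg_power \<delta> r (a + b) \<le> 3 powr r * (\<delta> powr (r / 2) + \<bar>a\<bar> powr r + \<bar>b\<bar> powr r)"
proof -
  have "\<delta> + (a + b)\<^sup>2 \<le> (sqrt \<delta> + \<bar>a + b\<bar>)\<^sup>2"
    using assms by (simp add: power2_sum)
  then have "reg_power \<delta> r (a + b) \<le> ((sqrt \<delta> + \<bar>a + b\<bar>)\<^sup>2) powr (r / 2)"
    unfolding reg_power_def using assms by (intro powr_mono2) auto
  also have "\<dots> = (sqrt \<delta> + \<bar>a + b\<bar>) powr r"
    using powr_powr[of "sqrt \<delta> + \<bar>a + b\<bar>" 2 "r / 2"] assms by (simp add: add_nonneg_nonneg)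
  also have "\<dots> \<le> \<bar>sqrt \<delta> + \<bar>a\<bar> + \<bar>b\<bar>\<bar> powr r"
    using assms by (intro powr_mono2) auto
  also have "\<dots> \<le> 3 powr r * (\<bar>sqrt \<delta>\<bar> powr r + \<bar>\<bar>a\<bar>\<bar> powr r + \<bar>\<bar>b\<bar>\<bar> powr r)"
    by (rule powr_sum3_le[OF assms(2)])
  also have "\<bar>sqrt \<delta>\<bar> powr r = \<delta> powr (r / 2)"
    using assms by (simp add: powr_half_sqrt[symmetric] powr_powr)
  finally show ?thesis by simp
qed

lemma abs_powr_le_reg_power:
  assumes "0 < \<delta>" "0 \<le> r"
  shows "\<bar>y\<bar> powr r \<le> reg_power \<delta> r y"
proof -
  have "\<bar>y\<bar> powr r = (\<bar>y\<bar>\<^sup>2) powr (r / 2)"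
    using powr_powr[of "\<bar>y\<bar>" 2 "r / 2"] by simp
  also have "\<dots> \<le> reg_power \<delta> r y"
    unfolding reg_power_def using assms by (intro powr_mono2) auto
  finally show ?thesis .
qed

lemma integral_cbox_eq_LINT:
  fixes h :: "'a::euclidean_space \<Rightarrow> real"
  assumes "continuous_on (cbox l u) h"
  shows "integral (cbox l u) h = (LINT x|lebesgue_on (cbox l u). h x)"
  using lebesgue_integral_eq_integral[OF continuous_imp_integrable[OF assms]] by simp

text \<open>For the earlier time: \<open>v - w\<close> is split through \<open>u0\<close>, so the
  energy is small when \<open>\<delta>\<close>, the distance of \<open>v\<close> from the datum and
  the approximation error of \<open>w\<close> are.\<close>

lemma energy_upper_bound:
  fixes v w u0 :: "'a::euclidean_space \<Rightarrow> real"
  assumes "0 < \<delta>" "0 < r" and \<phi>: "continuous_on (cbox l u) \<phi>" "\<And>x. 0 \<le> \<phi> x" "\<And>x. \<phi> x \<le> \<Phi>"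
    and v: "continuous_on (cbox l u) v" and w: "continuous_on (cbox l u) w" and u0: "u0 \<in> Lp_space r (cbox l u)"
  shows "integral (cbox l u) (\<lambda>x. \<phi> x * reg_power \<delta> r (v x - w x)) \<le>
    \<Phi> * (3 powr r * (\<delta> powr (r / 2) * measure lebesgue (cbox l u) +
      Lp_int r (cbox l u) (\<lambda>x. v x - u0 x) + Lp_int r (cbox l u) (\<lambda>x. u0 x - w x)))"
proof -
  have c: "continuous_on (cbox l u) (\<lambda>x. \<phi> x * reg_power \<delta> r (v x - w x))"
    using assms by (intro continuous_intros continuous_on_reg_power) auto
  have L: "v \<in> Lp_space r (cbox l u)" "w \<in> Lp_space r (cbox l u)"
    using v w assms(2) by (auto intro: Lp_space_continuous)
  have i: "integrable (lebesgue_on (cbox l u)) (\<lambda>x. \<bar>v x - u0 x\<bar> powr r)"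
    "integrable (lebesgue_on (cbox l u)) (\<lambda>x. \<bar>u0 x - w x\<bar> powr r)"
    using Lp_space_diff[OF L(1) u0] Lp_space_diff[OF u0 L(2)] assms(2) by (simp_all add: Lp_space_def)
  have ic: "integrable (lebesgue_on (cbox l u)) (\<lambda>_. \<delta> powr (r / 2))"
    by (intro continuous_imp_integrable continuous_intros)
  have "integral (cbox l u) (\<lambda>x. \<phi> x * reg_power \<delta> r (v x - w x)) =
      (LINT x|lebesgue_on (cbox l u). \<phi> x * reg_power \<delta> r (v x - w x))"
    by (rule integral_cbox_eq_LINT[OF c])
  also have "\<dots> \<le> (LINT x|lebesgue_on (cbox l u). \<Phi> * (3 powr r * (\<delta> powr (r / 2) + \<bar>v x - u0 x\<bar> powr r + \<bar>u0 x - w x\<bar> powr r)))"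
  proof (rule integral_mono)
    show "integrable (lebesgue_on (cbox l u)) (\<lambda>x. \<phi> x * reg_power \<delta> r (v x - w x))"
      by (rule continuous_imp_integrable[OF c])
    show "integrable (lebesgue_on (cbox l u)) (\<lambda>x. \<Phi> * (3 powr r * (\<delta> powr (r / 2) + \<bar>v x - u0 x\<bar> powr r + \<bar>u0 x - w x\<bar> powr r)))"
      by (intro Bochner_Integration.integrable_mult_right Bochner_Integration.integrable_add i ic)
    fix x
    have "reg_power \<delta> r (v x - w x) \<le> 3 powr r * (\<delta> powr (r / 2) + \<bar>v x - u0 x\<bar> powr r + \<bar>u0 x - w x\<bar> powr r)"
      using reg_power_add_le[of \<delta> r "v x - u0 x" "u0 x - w x"] assms by simp
    moreover have "0 \<le> reg_power \<delta> r (v x - w x)" by (simp add: reg_power_def)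
    ultimately show "\<phi> x * reg_power \<delta> r (v x - w x) \<le>
        \<Phi> * (3 powr r * (\<delta> powr (r / 2) + \<bar>v x - u0 x\<bar> powr r + \<bar>u0 x - w x\<bar> powr r))"
      using \<phi>(2,3)[of x] by (intro mult_mono) auto
  qed
  also have "\<dots> = \<Phi> * (3 powr r * (\<delta> powr (r / 2) * measure lebesgue (cbox l u) +
      Lp_int r (cbox l u) (\<lambda>x. v x - u0 x) + Lp_int r (cbox l u) (\<lambda>x. u0 x - w x)))"
    using i ic by (simp add: Lp_int_def measure_restrict_space mult.commute)
  finally show ?thesis .
qed

lemma energy_lower_bound:
  fixes v w :: "'a::euclidean_space \<Rightarrow> real"
  assumes "0 < \<delta>" "0 < r" and \<phi>: "continuous_on (cbox l u) \<phi>" "\<And>x. 0 \<le> \<phi> x" "\<And>x. x \<in> B \<Longrightarrow> \<kappa> \<le> \<phi> x"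
    and v: "continuous_on (cbox l u) v" and w: "continuous_on (cbox l u) w"
    and B: "B \<subseteq> cbox l u" "B \<in> sets lebesgue"
  shows "\<kappa> * Lp_int r B (\<lambda>x. v x - w x) \<le> integral (cbox l u) (\<lambda>x. \<phi> x * reg_power \<delta> r (v x - w x))"
proof -
  have c: "continuous_on (cbox l u) (\<lambda>x. \<phi> x * reg_power \<delta> r (v x - w x))"
    using assms by (intro continuous_intros continuous_on_reg_power) auto
  have i1: "integrable lebesgue (\<lambda>x. indicator (cbox l u) x *\<^sub>R (\<phi> x * reg_power \<delta> r (v x - w x)))"
    using continuous_imp_integrable[OF c] by (simp add: integrable_restrict_space)
  have "(\<lambda>x. v x - w x) \<in> Lp_space r (cbox l u)"
    using assms(2) by (intro Lp_space_continuous continuous_intros v w)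
  then have "(\<lambda>x. v x - w x) \<in> Lp_space r B"
    by (rule Lp_space_subset) (use B in auto)
  then have i2: "integrable lebesgue (\<lambda>x. indicator B x *\<^sub>R \<bar>v x - w x\<bar> powr r)"
    using B by (simp add: Lp_space_def integrable_restrict_space)
  have "\<kappa> * Lp_int r B (\<lambda>x. v x - w x) = (LINT x|lebesgue. \<kappa> * (indicator B x *\<^sub>R \<bar>v x - w x\<bar> powr r))"
    using B by (simp add: Lp_int_def integral_restrict_space)
  also have "\<dots> \<le> (LINT x|lebesgue. indicator (cbox l u) x *\<^sub>R (\<phi> x * reg_power \<delta> r (v x - w x)))"
  proof (rule integral_mono[OF Bochner_Integration.integrable_mult_right[OF i2] i1])
    fix x
    have "0 \<le> \<phi> x * reg_power \<delta> r (v x - w x)" using \<phi>(2)[of x] by (simp add: reg_power_def)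
    moreover have "\<kappa> * \<bar>v x - w x\<bar> powr r \<le> \<phi> x * reg_power \<delta> r (v x - w x)" if "x \<in> B"
      using \<phi>(2,3) that assms(1,2) by (intro mult_mono abs_powr_le_reg_power) auto
    ultimately show "\<kappa> * (indicator B x *\<^sub>R \<bar>v x - w x\<bar> powr r) \<le> indicator (cbox l u) x *\<^sub>R (\<phi> x * reg_power \<delta> r (v x - w x))"
      using B(1) by (auto simp: indicator_def)
  qed
  also have "\<dots> = integral (cbox l u) (\<lambda>x. \<phi> x * reg_power \<delta> r (v x - w x))"
    unfolding integral_cbox_eq_LINT[OF c] by (simp add: integral_restrict_space)
  finally show ?thesis .
qed

text \<open>Order of choices: \<open>e\<close> determines \<open>\<delta>\<close> and
  \<open>w\<close>, these determine \<open>K\<close> and the time span \<open>\<tau>\<close>; then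
  \<open>t\<close> determines \<open>j\<close>, and \<open>j\<close> determines \<open>s\<close>.
  The triangle estimate leads from \<open>u t\<close> through \<open>V j t\<close> and
  \<open>w\<close> to \<open>u0\<close>.\<close>

lemma local_Lp_convergence:
  fixes \<Omega> :: "'a::euclidean_space set" and u0 :: "'a \<Rightarrow> real"
  assumes \<Omega>: "open \<Omega>" and f: "power_growth p c C A0 A1 f" and pos: "0 < c" "1 < p" "0 \<le> A0"
    and r: "1 \<le> r" and u0: "u0 \<in> Lp_space r \<Omega>"
    and V: "\<And>j. classical_solution \<Omega> f (g j) (V j)" "\<And>j t. 0 < t \<Longrightarrow> V j t \<in> Lp_space r \<Omega>"
    and V0: "\<And>j e. 0 < e \<Longrightarrow> \<forall>\<^sub>F s in at_right 0. Lp_int r \<Omega> (\<lambda>x. V j s x - u0 x) < e"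
    and u: "\<And>t. 0 < t \<Longrightarrow> u t \<in> Lp_space r \<Omega>"
    and Vu: "\<And>t e. 0 < t \<Longrightarrow> 0 < e \<Longrightarrow> \<exists>j. Lp_int r \<Omega> (\<lambda>x. V j t x - u t x) < e"
    and x0: "x0 \<in> \<Omega>"
  obtains \<rho> where "0 < \<rho>" "cball x0 \<rho> \<subseteq> \<Omega>"
    "((\<lambda>t. Lp_int r (cball x0 \<rho>) (\<lambda>x. u t x - u0 x)) \<longlongrightarrow> 0) (at_right 0)"
proof -
  have \<Omega>m: "\<Omega> \<in> sets lebesgue" using \<Omega> by simp
  have r0: "0 < r" "0 \<le> r" using r by auto
  obtain l m where Q: "cbox l m \<subseteq> \<Omega>" "x0 \<in> box l m"
    using open_contains_cbox[OF \<Omega> x0] by metis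
  obtain R where R: "0 < R" "cball x0 R \<subseteq> box l m"
    using open_box Q(2) open_contains_cball by blast
  have ball: "cball x0 R \<subseteq> cbox l m" using R(2) box_subset_cbox by blast
  obtain k0 :: nat where "r / (p - 1) \<le> real k0" using real_arch_simple by blast
  \<comment> \<open>The successor makes the exponent positive, as the second derivative of the
    cutoff requires.\<close>
  then have k: "0 < Suc k0" "r \<le> real (Suc k0) * (p - 1)"
    using pos(2) by (auto simp: field_simps)
  define k where "k = Suc k0"
  define B where "B = cball x0 (R / 2)"
  have BQ: "B \<subseteq> cbox l m" "B \<in> sets lebesgue" using ball R(1) by (force simp: B_def)+
  have B\<Omega>: "B \<subseteq> \<Omega>" using BQ Q by blast
  define \<phi> where "\<phi> = cutoff x0 R (Suc (Suc (2 * k)))"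
  \<comment> \<open>At distance at most \<open>R / 2\<close> from \<open>x0\<close> the base of the
    cutoff is at least \<open>3 / 4 * R\<^sup>2\<close>.\<close>
  define \<kappa> where "\<kappa> = (3 / 4 * R\<^sup>2) ^ Suc (Suc (2 * k))"
  define \<Phi> where "\<Phi> = (R\<^sup>2) ^ Suc (Suc (2 * k))"
  have \<kappa>: "0 < \<kappa>" unfolding \<kappa>_def using R(1) by (intro zero_less_power) simp
  have \<Phi>: "0 \<le> \<Phi>" unfolding \<Phi>_def by (rule zero_le_power[OF zero_le_power2])
  have \<phi>: "continuous_on (cbox l m) \<phi>" "\<And>x. 0 \<le> \<phi> x"
    by (simp_all add: \<phi>_def cutoff_nonneg continuous_on_cutoff)
  have \<phi>_le: "\<phi> x \<le> \<Phi>" for x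
    unfolding \<phi>_def cutoff_def \<Phi>_def by (intro power_mono) auto
  have \<phi>_ge: "\<kappa> \<le> \<phi> x" if "x \<in> B" for x
  proof -
    have "(norm (x - x0))\<^sup>2 \<le> (R / 2)\<^sup>2"
      using that by (intro power_mono) (auto simp: B_def dist_norm norm_minus_commute)
    then have "3 / 4 * R\<^sup>2 \<le> R\<^sup>2 - (norm (x - x0))\<^sup>2" by (simp add: power_divide)
    then have "3 / 4 * R\<^sup>2 \<le> max 0 (R\<^sup>2 - (norm (x - x0))\<^sup>2)" by (rule max.coboundedI2)
    then show ?thesis unfolding \<phi>_def cutoff_def \<kappa>_def by (intro power_mono) auto
  qed
  have Vc: "continuous_on (cbox l m) (V j t)" if "0 < t" for j t
    by (rule continuous_on_subset[OF classical_solution_partials(3)[OF V(1) that SOME_Basis] Q(1)])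
  have inQ: "h \<in> Lp_space r (cbox l m)" if "h \<in> Lp_space r \<Omega>" for h
    by (rule Lp_space_subset[OF that Q(1)]) (use \<Omega>m in auto)
  have inB: "h \<in> Lp_space r B" if "h \<in> Lp_space r (cbox l m)" for h
    by (rule Lp_space_subset[OF that BQ]) auto
  define A where "A = 3 powr r"
  have A: "0 < A" by (simp add: A_def)
  have "\<forall>\<^sub>F t in at_right 0. Lp_int r B (\<lambda>x. u t x - u0 x) < e" if e: "0 < e" for e
  proof -
    \<comment> \<open>The final error in units of \<open>\<epsilon>\<close>: 1 for
      \<open>u t - V j t\<close>, 1 for \<open>w - u0\<close>, and
      \<open>1 + 3 * \<Phi> * A / \<kappa>\<close> for \<open>V j t - w\<close>. The outer factor
      \<open>A\<close> is that of the triangle estimate.\<close>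
    define G where "G = A * (3 + 3 * \<Phi> * A / \<kappa>)"
    have G: "0 < G" using A \<Phi> \<kappa> by (simp add: G_def add_pos_nonneg)
    define \<epsilon> where "\<epsilon> = e / G"
    have \<epsilon>: "0 < \<epsilon>" using e G by (simp add: \<epsilon>_def)
    define \<mu> where "\<mu> = measure lebesgue (cbox l m)"
    have \<mu>: "0 \<le> \<mu>" by (simp add: \<mu>_def)
    \<comment> \<open>Solves \<open>\<delta> powr (r / 2) * (\<mu> + 1) = \<epsilon>\<close>, so the
      regularisation costs at most \<open>\<epsilon>\<close> on the box.\<close>
    define \<delta> where "\<delta> = (\<epsilon> / (\<mu> + 1)) powr (2 / r)"
    have \<delta>: "0 < \<delta>" using \<epsilon> \<mu> by (simp add: \<delta>_def)
    have "\<delta> powr (r / 2) * \<mu> = \<epsilon> / (\<mu> + 1) * \<mu>"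
      using r0 \<epsilon> \<mu> by (simp add: \<delta>_def powr_powr)
    also have "\<dots> \<le> \<epsilon>" using \<epsilon> \<mu> by (simp add: field_simps)
    finally have \<delta>\<mu>: "\<delta> powr (r / 2) * \<mu> \<le> \<epsilon>" .
    obtain w where w: "real_polynomial_function w" "Lp_int r (cbox l m) (\<lambda>x. u0 x - w x) < \<epsilon>"
      using Lp_polynomial_approx[OF inQ[OF u0] r0(1) \<epsilon>] by blast
    have wc: "continuous_on (cbox l m) w" by (rule continuous_on_real_polynomial_function[OF w(1)])
    have wL: "w \<in> Lp_space r (cbox l m)" by (rule Lp_space_continuous[OF wc r0(1)])
    obtain K where K: "\<And>g v s t. classical_solution \<Omega> f g v \<Longrightarrow> 0 < s \<Longrightarrow> s \<le> t \<Longrightarrow>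
      integral (cbox l m) (\<lambda>x. \<phi> x * reg_power \<delta> r (v t x - w x)) \<le>
      integral (cbox l m) (\<lambda>x. \<phi> x * reg_power \<delta> r (v s x - w x)) + K * (t - s)"
      unfolding \<phi>_def k_def
      by (rule energy_inequality[OF \<Omega> Q(1) ball f pos \<delta> r less_imp_le[OF R(1)] k w(1)]) blast
    \<comment> \<open>Chosen for \<open>\<bar>K\<bar> * \<tau> \<le> \<kappa> * \<epsilon>\<close>,
      so that the growth of the energy costs at most \<open>\<epsilon>\<close> after division by
      \<open>\<kappa>\<close>; the summand 1 covers \<open>K = 0\<close>.\<close>
    define \<tau> where "\<tau> = \<kappa> * \<epsilon> / (\<bar>K\<bar> + 1)"
    have \<tau>: "0 < \<tau>" using \<kappa> \<epsilon> by (simp add: \<tau>_def)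
    have main: "Lp_int r B (\<lambda>x. u t x - u0 x) < e" if t: "0 < t" "t < \<tau>" for t
    proof -
      obtain j where j: "Lp_int r \<Omega> (\<lambda>x. V j t x - u t x) < \<epsilon>" using Vu[OF t(1) \<epsilon>] by blast
      have "\<forall>\<^sub>F s in at_right 0. s < t" using t(1) unfolding eventually_at_right_field by blast
      moreover have "\<forall>\<^sub>F s in at_right (0::real). 0 < s" by (rule eventually_at_right_less)
      ultimately have "\<forall>\<^sub>F s in at_right 0. 0 < s \<and> s < t \<and> Lp_int r \<Omega> (\<lambda>x. V j s x - u0 x) < \<epsilon>"
        using V0[OF \<epsilon>, of j] by eventually_elim simp
      then obtain s where s: "0 < s" "s < t" "Lp_int r \<Omega> (\<lambda>x. V j s x - u0 x) < \<epsilon>"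
        using eventually_happens'[OF trivial_limit_at_right_real] by blast
      have "Lp_int r (cbox l m) (\<lambda>x. V j s x - u0 x) \<le> Lp_int r \<Omega> (\<lambda>x. V j s x - u0 x)"
        by (intro Lp_int_mono Lp_space_diff V s u0 r0 Q \<Omega>m) simp
      then have sum: "\<delta> powr (r / 2) * \<mu> + Lp_int r (cbox l m) (\<lambda>x. V j s x - u0 x) +
          Lp_int r (cbox l m) (\<lambda>x. u0 x - w x) \<le> 3 * \<epsilon>"
        using \<delta>\<mu> s(3) w(2) by linarith
      have "\<kappa> * Lp_int r B (\<lambda>x. V j t x - w x) \<le> integral (cbox l m) (\<lambda>x. \<phi> x * reg_power \<delta> r (V j t x - w x))"
        by (rule energy_lower_bound[OF \<delta> r0(1) \<phi> \<phi>_ge Vc[OF t(1)] wc BQ])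
      also have "\<dots> \<le> integral (cbox l m) (\<lambda>x. \<phi> x * reg_power \<delta> r (V j s x - w x)) + K * (t - s)"
        using K[OF V(1) s(1)] s(2) by simp
      finally have step: "\<kappa> * Lp_int r B (\<lambda>x. V j t x - w x) \<le> \<dots>" .
      have "integral (cbox l m) (\<lambda>x. \<phi> x * reg_power \<delta> r (V j s x - w x)) \<le>
          \<Phi> * (A * (\<delta> powr (r / 2) * \<mu> + Lp_int r (cbox l m) (\<lambda>x. V j s x - u0 x) +
            Lp_int r (cbox l m) (\<lambda>x. u0 x - w x)))"
        unfolding A_def \<mu>_def by (rule energy_upper_bound[OF \<delta> r0(1) \<phi> \<phi>_le Vc[OF s(1)] wc inQ[OF u0]])
      also have "\<dots> \<le> \<Phi> * (A * (3 * \<epsilon>))"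
        using sum A \<Phi> by (intro mult_left_mono) auto
      finally have initial: "integral (cbox l m) (\<lambda>x. \<phi> x * reg_power \<delta> r (V j s x - w x)) \<le> \<dots>" .
      have "K * (t - s) \<le> \<bar>K\<bar> * (t - s)" using s by (intro mult_right_mono) auto
      also have "\<dots> \<le> \<bar>K\<bar> * \<tau>" using s t by (intro mult_left_mono) auto
      also have "\<dots> \<le> \<kappa> * \<epsilon>"
        using \<kappa> \<epsilon> by (simp add: \<tau>_def field_simps)
      finally have "\<kappa> * Lp_int r B (\<lambda>x. V j t x - w x) \<le> \<Phi> * (A * (3 * \<epsilon>)) + \<kappa> * \<epsilon>"
        using step initial by linarith
      then have 1: "Lp_int r B (\<lambda>x. V j t x - w x) \<le> \<epsilon> * (1 + 3 * \<Phi> * A / \<kappa>)"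
        using \<kappa> by (simp add: field_simps)
      have "Lp_int r B (\<lambda>x. u t x - V j t x) \<le> Lp_int r \<Omega> (\<lambda>x. u t x - V j t x)"
        by (intro Lp_int_mono Lp_space_diff V t u r0 B\<Omega> BQ \<Omega>m)
      then have 2: "Lp_int r B (\<lambda>x. u t x - V j t x) < \<epsilon>"
        using j by (simp add: Lp_int_commute[of r \<Omega> "u t"])
      have "Lp_int r B (\<lambda>x. w x - u0 x) \<le> Lp_int r (cbox l m) (\<lambda>x. w x - u0 x)"
        by (intro Lp_int_mono Lp_space_diff wL inQ u0 r0 BQ) simp
      then have 3: "Lp_int r B (\<lambda>x. w x - u0 x) < \<epsilon>"
        using w(2) by (simp add: Lp_int_commute[of r "cbox l m" w])
      have "Lp_int r B (\<lambda>x. u t x - u0 x) \<le> A * (Lp_int r B (\<lambda>x. u t x - V j t x) +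
          Lp_int r B (\<lambda>x. V j t x - w x) + Lp_int r B (\<lambda>x. w x - u0 x))"
        unfolding A_def by (intro Lp_int_triangle inB inQ u V t wL u0 r0)
      also have "\<dots> < A * (\<epsilon> * (3 + 3 * \<Phi> * A / \<kappa>))"
        using 1 2 3 A by (intro mult_strict_left_mono) (auto simp: algebra_simps)
      also have "\<dots> = e" using G by (simp add: \<epsilon>_def G_def field_simps)
      finally show ?thesis .
    qed
    show ?thesis
      unfolding eventually_at_right_field using \<tau> main by blast
  qed
  then have "((\<lambda>t. Lp_int r B (\<lambda>x. u t x - u0 x)) \<longlongrightarrow> 0) (at_right 0)"
    by (intro order_tendstoI) (auto intro: always_eventually less_le_trans[OF _ Lp_int_nonneg])
  then show thesis
    using that[of "R / 2"] R(1) B\<Omega> by (simp add: B_def)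
qed

section \<open>Lower exponents and compact subsets\<close>

text \<open>Splitting at height \<open>d\<close> replaces Hoelder's inequality: below
  \<open>d\<close> the first summand suffices, and above it the nonpositive exponent
  \<open>\<alpha> - r\<close> gives the second. \<open>d\<close> stays free so that the first
  summand can be made small.\<close>

lemma abs_powr_le_powr_add:
  fixes y \<alpha> r d :: real
  assumes "0 < \<alpha>" "\<alpha> \<le> r" "0 < d"
  shows "\<bar>y\<bar> powr \<alpha> \<le> d powr \<alpha> + d powr (\<alpha> - r) * \<bar>y\<bar> powr r"
proof (cases "\<bar>y\<bar> \<le> d")
  case True
  then have "\<bar>y\<bar> powr \<alpha> \<le> d powr \<alpha>" using assms by (intro powr_mono2) auto
  then show ?thesis by (simp add: add_increasing2)
next
  case False
  then have "\<bar>y\<bar> powr \<alpha> = \<bar>y\<bar> powr (\<alpha> - r) * \<bar>y\<bar> powr r"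
    using assms by (simp add: powr_add[symmetric])
  also have "\<dots> \<le> d powr (\<alpha> - r) * \<bar>y\<bar> powr r"
    using False assms by (intro mult_right_mono powr_mono2') auto
  finally show ?thesis using powr_ge_zero[of d \<alpha>] by linarith
qed

lemma Lp_space_compact_mono:
  assumes h: "h \<in> Lp_space r C" and C: "compact C" and \<alpha>: "0 < \<alpha>" "\<alpha> \<le> r"
  shows "h \<in> Lp_space \<alpha> C"
    "0 < d \<Longrightarrow> Lp_int \<alpha> C h \<le> d powr \<alpha> * measure lebesgue C + d powr (\<alpha> - r) * Lp_int r C h"
proof -
  have Cm: "C \<in> lmeasurable" using C by (rule lmeasurable_compact)
  have [measurable]: "h \<in> borel_measurable (lebesgue_on C)" and ih: "integrable (lebesgue_on C) (\<lambda>x. \<bar>h x\<bar> powr r)"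
    using h by (auto simp: Lp_space_def)
  have ic: "integrable (lebesgue_on C) (\<lambda>_. d)" for d :: real
    by (rule finite_measure.integrable_const[OF finite_measure_lebesgue_on[OF Cm]])
  have i: "integrable (lebesgue_on C) (\<lambda>x. d powr \<alpha> + d powr (\<alpha> - r) * \<bar>h x\<bar> powr r)" for d
    using ih by (intro Bochner_Integration.integrable_add ic Bochner_Integration.integrable_mult_right)
  have i\<alpha>: "integrable (lebesgue_on C) (\<lambda>x. \<bar>h x\<bar> powr \<alpha>)"
  proof (rule Bochner_Integration.integrable_bound[OF i[of 1]])
    show "AE x in lebesgue_on C. norm (\<bar>h x\<bar> powr \<alpha>) \<le> norm (1 powr \<alpha> + 1 powr (\<alpha> - r) * \<bar>h x\<bar> powr r)"
      using abs_powr_le_powr_add[OF \<alpha> zero_less_one] by simp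
  qed simp
  then show "h \<in> Lp_space \<alpha> C" by (simp add: Lp_space_def)
  assume d: "0 < d"
  have "Lp_int \<alpha> C h \<le> (LINT x|lebesgue_on C. d powr \<alpha> + d powr (\<alpha> - r) * \<bar>h x\<bar> powr r)"
    unfolding Lp_int_def by (intro integral_mono i\<alpha> i abs_powr_le_powr_add \<alpha> d)
  also have "\<dots> = d powr \<alpha> * measure lebesgue C + d powr (\<alpha> - r) * Lp_int r C h"
    using ih ic Cm by (simp add: Lp_int_def measure_restrict_space fmeasurableD mult.commute)
  finally show "Lp_int \<alpha> C h \<le> d powr \<alpha> * measure lebesgue C + d powr (\<alpha> - r) * Lp_int r C h" .
qed

lemma tendsto_Lp_int_lower_exponent:
  assumes C: "compact C" and \<alpha>: "0 < \<alpha>" "\<alpha> \<le> r"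
    and h: "\<forall>\<^sub>F t in F. h t \<in> Lp_space r C" and lim: "((\<lambda>t. Lp_int r C (h t)) \<longlongrightarrow> 0) F"
  shows "((\<lambda>t. Lp_int \<alpha> C (h t)) \<longlongrightarrow> 0) F"
proof (intro order_tendstoI)
  fix e :: real assume e: "0 < e"
  define \<mu> where "\<mu> = measure lebesgue C"
  have \<mu>: "0 \<le> \<mu>" by (simp add: \<mu>_def)
  \<comment> \<open>\<open>d\<close> is fixed before the limit, so that the measure term is at most
    \<open>e / 2\<close>; the possibly large factor \<open>d powr (\<alpha> - r)\<close> is then a
    constant.\<close>
  define d where "d = (e / (2 * (\<mu> + 1))) powr (1 / \<alpha>)"
  have d: "0 < d" using e \<mu> by (simp add: d_def)
  have "d powr \<alpha> * \<mu> = e / (2 * (\<mu> + 1)) * \<mu>"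
    using \<alpha> e \<mu> by (simp add: d_def powr_powr)
  also have "\<dots> \<le> e / 2" using e \<mu> by (simp add: field_simps)
  finally have small: "d powr \<alpha> * \<mu> \<le> e / 2" .
  have "0 < e / 2 / d powr (\<alpha> - r)" using e d by simp
  with lim have "\<forall>\<^sub>F t in F. Lp_int r C (h t) < e / 2 / d powr (\<alpha> - r)"
    by (rule order_tendstoD)
  with h show "\<forall>\<^sub>F t in F. Lp_int \<alpha> C (h t) < e"
  proof eventually_elim
    case (elim t)
    have "d powr (\<alpha> - r) * Lp_int r C (h t) < e / 2"
      using elim(2) d by (simp add: field_simps)
    then show ?case
      using Lp_space_compact_mono(2)[OF elim(1) C \<alpha> d] small unfolding \<mu>_def by linarith
  qed
qed (auto intro: always_eventually less_le_trans[OF _ Lp_int_nonneg])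

text \<open>Open balls give the finite subcover, and the closed balls around them carry the
  convergence.\<close>

lemma tendsto_Lp_int_compact:
  fixes h :: "real \<Rightarrow> 'a::euclidean_space \<Rightarrow> real"
  assumes \<Omega>: "open \<Omega>" and h: "\<forall>\<^sub>F t in F. h t \<in> Lp_space r \<Omega>"
    and loc: "\<And>x. x \<in> \<Omega> \<Longrightarrow> \<exists>\<rho>>0. cball x \<rho> \<subseteq> \<Omega> \<and> ((\<lambda>t. Lp_int r (cball x \<rho>) (h t)) \<longlongrightarrow> 0) F"
    and C: "compact C" "C \<subseteq> \<Omega>"
  shows "((\<lambda>t. Lp_int r C (h t)) \<longlongrightarrow> 0) F"
proof -
  obtain \<rho> where \<rho>: "\<And>x. x \<in> \<Omega> \<Longrightarrow> 0 < \<rho> x" "\<And>x. x \<in> \<Omega> \<Longrightarrow> cball x (\<rho> x) \<subseteq> \<Omega>"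
    "\<And>x. x \<in> \<Omega> \<Longrightarrow> ((\<lambda>t. Lp_int r (cball x (\<rho> x)) (h t)) \<longlongrightarrow> 0) F"
    using loc by metis
  have "C \<subseteq> (\<Union>x\<in>C. ball x (\<rho> x))" using \<rho>(1) C(2) by force
  then obtain I where I: "I \<subseteq> C" "finite I" "C \<subseteq> (\<Union>x\<in>I. ball x (\<rho> x))"
    using compactE_image[OF C(1), of C "\<lambda>x. ball x (\<rho> x)"] by auto
  have cover: "C \<subseteq> (\<Union>x\<in>I. cball x (\<rho> x))" using I(3) ball_subset_cball by blast
  have Cm: "C \<in> sets lebesgue" using C(1) by (simp add: fmeasurableD lmeasurable_compact)
  have "((\<lambda>t. \<Sum>x\<in>I. Lp_int r (cball x (\<rho> x)) (h t)) \<longlongrightarrow> (\<Sum>x\<in>I. 0)) F"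
    using I C by (intro tendsto_sum \<rho>) blast
  then have lim: "((\<lambda>t. \<Sum>x\<in>I. Lp_int r (cball x (\<rho> x)) (h t)) \<longlongrightarrow> 0) F" by simp
  have nonneg: "\<forall>\<^sub>F t in F. 0 \<le> Lp_int r C (h t)" by (simp add: Lp_int_nonneg)
  have le: "\<forall>\<^sub>F t in F. Lp_int r C (h t) \<le> (\<Sum>x\<in>I. Lp_int r (cball x (\<rho> x)) (h t))"
    using h
  proof eventually_elim
    case (elim t)
    show ?case
    proof (rule Lp_int_finite_cover[OF I(2) cover _ _ Cm])
      show "h t \<in> Lp_space r (cball x (\<rho> x))" if "x \<in> I" for x
      proof (rule Lp_space_subset[OF elim])
        show "cball x (\<rho> x) \<subseteq> \<Omega>" using that I(1) C(2) by (intro \<rho>(2)) blast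
      qed (use \<Omega> in auto)
      show "h t \<in> Lp_space r C"
        by (rule Lp_space_subset[OF elim C(2) Cm]) (use \<Omega> in auto)
    qed simp
  qed
  show ?thesis
    by (rule tendsto_sandwich[OF nonneg le tendsto_const lim])
qed

lemma mild_solution_Lp_int_initial:
  assumes mild: "mild_solution \<Omega> k f g r u0 v" and \<Omega>: "\<Omega> \<in> sets lebesgue"
    and u0: "u0 \<in> Lp_space r \<Omega>" and r: "0 < r"
  shows "0 < t \<Longrightarrow> v t \<in> Lp_space r \<Omega>"
    "0 < e \<Longrightarrow> \<forall>\<^sub>F s in at_right 0. Lp_int r \<Omega> (\<lambda>x. v s x - u0 x) < e"
proof -
  have path: "continuous_path (Lp_space r \<Omega>) (Lp_norm r \<Omega>) {0..T} v" if "0 < T" for T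
  proof -
    \<comment> \<open>In \<open>mild_solution\<close> the path condition stands under a quantifier
      over pairs \<open>\<epsilon> < T\<close>; any such \<open>\<epsilon>\<close> releases
      it.\<close>
    have "0 < T / 2 \<and> T / 2 < T" using that by simp
    then show ?thesis using mild unfolding mild_solution_def by blast
  qed
  show v: "v t \<in> Lp_space r \<Omega>" if "0 < t" for t
    using path[OF that] that by (simp add: continuous_path_def)
  have v0: "v 0 \<in> Lp_space r \<Omega>"
    using path[OF zero_less_one] by (simp add: continuous_path_def)
  have "((\<lambda>s. Lp_norm r \<Omega> (\<lambda>x. v s x - v 0 x)) \<longlongrightarrow> 0) (at 0 within {0..1})"
    using path[OF zero_less_one] by (simp add: continuous_path_def)
  then have lim: "((\<lambda>s. Lp_norm r \<Omega> (\<lambda>x. v s x - v 0 x)) \<longlongrightarrow> 0) (at_right 0)"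
    by (simp add: at_within_Icc_at_right)
  have ae: "AE x in lebesgue_on \<Omega>. v 0 x = u0 x" using mild by (simp add: mild_solution_def)
  assume e: "0 < e"
  have "\<forall>\<^sub>F s in at_right 0. Lp_norm r \<Omega> (\<lambda>x. v s x - v 0 x) < e powr (1 / r)"
    using order_tendstoD(2)[OF lim, of "e powr (1 / r)"] e by simp
  moreover have "\<forall>\<^sub>F s in at_right (0::real). 0 < s" by (rule eventually_at_right_less)
  ultimately show "\<forall>\<^sub>F s in at_right 0. Lp_int r \<Omega> (\<lambda>x. v s x - u0 x) < e"
  proof eventually_elim
    case (elim s)
    have "AE x in lebesgue_on \<Omega>. v s x - v 0 x = v s x - u0 x" using ae by eventually_elim simp
    then have "Lp_int r \<Omega> (\<lambda>x. v s x - u0 x) = Lp_int r \<Omega> (\<lambda>x. v s x - v 0 x)"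
      using r by (intro Lp_AE_cong(2) Lp_space_diff v v0 elim \<Omega>) auto
    also have "\<dots> < (e powr (1 / r)) powr r"
      using elim(1) e by (intro iffD1[OF Lp_int_less_iff[OF r]]) auto
    finally show ?case using r e by (simp add: powr_powr)
  qed
qed

theorem theorem3p16:
  fixes \<Omega> :: "'a::euclidean_space set"
    and k :: "real \<Rightarrow> 'a \<Rightarrow> 'a \<Rightarrow> real"
    and f g :: "real \<Rightarrow> real"
    and gK :: "real \<Rightarrow> real \<Rightarrow> real"
    and p q cf cg Cf Cg A0 A1 B0 B1 r0 r :: real
    and u0 :: "'a \<Rightarrow> real"
    and u :: "real \<Rightarrow> 'a \<Rightarrow> real"
  assumes "smooth_bounded_domain \<Omega>"
    and "neumann_heat_kernel \<Omega> k"
    and "cf > 0" "cg > 0" "Cf > 0" "Cg > 0" "A0 > 0" "A1 > 0" "B0 > 0" "B1 > 0"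
    and "1 < p" "1 < q" "p + 1 > 2 * q" "p > 1 + 2 / real DIM('a)"
    and "power_growth p cf Cf A0 A1 f"
    and "power_growth q cg Cg B0 B1 g"
    and "truncation_family B0 g gK"
    and "r0 = max (real DIM('a) / 2 * (p - 1)) (real DIM('a) * (q - 1))"
    and "1 < r" "r < r0"
    and "u0 \<in> Lp_space r \<Omega>"
    and "solution_P \<Omega> k f gK r u0 u"
  shows "\<forall>\<alpha>. 1 \<le> \<alpha> \<and> \<alpha> < r \<longrightarrow> tendsto_Lp_loc \<alpha> \<Omega> u u0 (at_right 0)"
proof (intro allI impI)
  fix \<alpha> :: real assume "1 \<le> \<alpha> \<and> \<alpha> < r"
  then have \<alpha>: "0 < \<alpha>" "\<alpha> \<le> r" by auto
  have r: "0 < r" "1 \<le> r" using \<open>1 < r\<close> by auto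
  note u0 = \<open>u0 \<in> Lp_space r \<Omega>\<close>
  have \<Omega>: "open \<Omega>" using assms(1) by (simp add: smooth_bounded_domain_def)
  then have \<Omega>m: "\<Omega> \<in> sets lebesgue" by simp
  obtain K :: "nat \<Rightarrow> real" and V where
    V: "\<And>j. truncated_solution \<Omega> k f (gK (K j)) r u0 (V j)"
    and lim: "\<And>\<sigma> \<alpha>. r \<le> \<sigma> \<Longrightarrow> 0 \<le> \<alpha> \<Longrightarrow> \<alpha> < 1 + 1 / \<sigma> \<Longrightarrow>
      converges_Cloc (bessel_space \<alpha> \<sigma> \<Omega>) (bessel_norm \<alpha> \<sigma> \<Omega>) V u"
    using \<open>solution_P \<Omega> k f gK r u0 u\<close> unfolding solution_P_def by blast
  have cs: "classical_solution \<Omega> f (gK (K j)) (V j)" for j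
    using V[of j] by (simp add: truncated_solution_def)
  have mild: "mild_solution \<Omega> k f (gK (K j)) r u0 (V j)" for j
    using V[of j] by (simp add: truncated_solution_def)
  note Vinit = mild_solution_Lp_int_initial[OF mild \<Omega>m u0 r(1)]
  \<comment> \<open>Order 0 and exponent \<open>r\<close> are the instance in which Bessel
    convergence yields convergence of the integrals \<open>Lp_int r \<Omega>\<close>.\<close>
  have conv: "converges_Cloc (bessel_space 0 r \<Omega>) (bessel_norm 0 r \<Omega>) V u"
    using lim[of r 0] r by (simp add: add_pos_pos)
  have Vb: "V j t \<in> bessel_space 0 r \<Omega>" and ub: "u t \<in> bessel_space 0 r \<Omega>" if "0 < t" for j t
    using conv that by (auto simp: converges_Cloc_def continuous_path_def)
  have uL: "u t \<in> Lp_space r \<Omega>" if "0 < t" for t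
    by (rule bessel_space_0[OF ub[OF that] \<Omega>m])
  have Vu: "\<exists>j. Lp_int r \<Omega> (\<lambda>x. V j t x - u t x) < e" if t: "0 < t" and e: "0 < e" for t e
  proof -
    define e' where "e' = e powr (1 / r)"
    have e': "0 < e'" using e by (simp add: e'_def)
    \<comment> \<open>A one-point time interval: convergence at each fixed \<open>t\<close> is
      enough, as \<open>j\<close> may depend on \<open>t\<close>.\<close>
    have "\<forall>\<^sub>F j in sequentially. \<forall>\<tau>\<in>{t..t}. bessel_norm 0 r \<Omega> (\<lambda>x. V j \<tau> x - u \<tau> x) < e'"
      using conv t e' unfolding converges_Cloc_def by blast
    then obtain j where "bessel_norm 0 r \<Omega> (\<lambda>x. V j t x - u t x) < e'"
      using eventually_sequentially by auto
    then have "Lp_int r \<Omega> (\<lambda>x. V j t x - u t x) < e' powr r"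
      by (rule Lp_int_less_bessel_norm_0[OF Vb[OF t] ub[OF t] \<Omega>m r(1) e'])
    then show ?thesis using r e by (auto simp: e'_def powr_powr)
  qed
  have loc: "\<exists>\<rho>>0. cball x \<rho> \<subseteq> \<Omega> \<and> ((\<lambda>t. Lp_int r (cball x \<rho>) (\<lambda>x. u t x - u0 x)) \<longlongrightarrow> 0) (at_right 0)"
    if x: "x \<in> \<Omega>" for x
    by (rule local_Lp_convergence[OF \<Omega> \<open>power_growth p cf Cf A0 A1 f\<close> \<open>cf > 0\<close> \<open>1 < p\<close> less_imp_le[OF \<open>A0 > 0\<close>] r(2) u0
        cs Vinit uL Vu x]) blast+
  have pos: "\<forall>\<^sub>F t in at_right (0::real). 0 < t" by (rule eventually_at_right_less)
  then have diff: "\<forall>\<^sub>F t in at_right 0. (\<lambda>x. u t x - u0 x) \<in> Lp_space r \<Omega>"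
    by eventually_elim (use r in \<open>intro Lp_space_diff uL u0; simp\<close>)
  have sub: "h \<in> Lp_space r C" if "h \<in> Lp_space r \<Omega>" "compact C" "C \<subseteq> \<Omega>" for h C
    using that \<Omega>m by (intro Lp_space_subset[OF that(1,3)]) (auto simp: fmeasurableD lmeasurable_compact)
  have loc_space: "h \<in> Lp_loc_space \<alpha> \<Omega>" if "h \<in> Lp_space r \<Omega>" for h
    unfolding Lp_loc_space_def using Lp_space_compact_mono(1)[OF sub[OF that] _ \<alpha>] by blast
  show "tendsto_Lp_loc \<alpha> \<Omega> u u0 (at_right 0)"
    unfolding tendsto_Lp_loc_def
  proof (intro conjI allI impI)
    show "u0 \<in> Lp_loc_space \<alpha> \<Omega>" by (rule loc_space[OF u0])
    show "\<forall>\<^sub>F t in at_right 0. u t \<in> Lp_loc_space \<alpha> \<Omega>"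
      using pos by eventually_elim (rule loc_space[OF uL])
    fix C :: "'a set" assume "compact C \<and> C \<subseteq> \<Omega>"
    then have C: "compact C" "C \<subseteq> \<Omega>" by auto
    have "\<forall>\<^sub>F t in at_right 0. (\<lambda>x. u t x - u0 x) \<in> Lp_space r C"
      using diff by eventually_elim (rule sub[OF _ C])
    \<comment> \<open>The exponent is lowered last, on one compact set, whose finite measure the
      splitting needs.\<close>
    then have "((\<lambda>t. Lp_int \<alpha> C (\<lambda>x. u t x - u0 x)) \<longlongrightarrow> 0) (at_right 0)"
      by (rule tendsto_Lp_int_lower_exponent[OF C(1) \<alpha>]) (rule tendsto_Lp_int_compact[OF \<Omega> diff loc C])
    then show "((\<lambda>t. Lp_norm \<alpha> C (\<lambda>x. u t x - u0 x)) \<longlongrightarrow> 0) (at_right 0)"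
      unfolding Lp_norm_eq using \<alpha>
      by (intro tendsto_zero_powrI[OF _ tendsto_const]) (auto simp: Lp_int_nonneg)
  qed
qed

end
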